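(* Let $\{\rho_k\}_{k\in\mathbb{N}}\subset\mathbb{R}$ with $\rho_k\to+\infty$ and let $\{x^k\}_{k\in\mathbb{N}}\subset\mathbb{R}^n$ converge to a feasible point $\bar{x}$ of (NSOCP), such that $$\nabla_x L\left(x^k,\rho_k\mathcal{P}_{\mathbb{L}_{m_1}}(-g_1(x^k)),\ldots,\rho_k\mathcal{P}_{\mathbb{L}_{m_q}}(-g_q(x^k))\right)\to 0 .$$ Suppose that weak-CPLD holds at $\bar{x}$. Then $\bar{x}$ satisfies the KKT conditions. Moreover, any local minimizer of (NSOCP) that satisfies weak-CPLD satisfies the KKT conditions.
   Context: Norms and inner products are Euclidean. For $m\ge 2$ write $y=(y_0,\widehat{y})\in\mathbb{R}\times\mathbb{R}^{m-1}$, and let $\mathbb{L}_m=\{y\in\mathbb{R}^m: y_0\ge\|\widehat{y}\|\}$ be the second-order cone. Let $\mathrm{bd}_+\mathbb{L}_m$ be its boundary minus the origin. $\mathcal{P}_C$ is the Euclidean projection onto the closed convex set $C$. Problem (NSOCP): minimize $f(x)$ over $x\in\mathbb{R}^n$ subject to $g_j(x)\in\mathbb{L}_{m_j}$, $j=1,\dots,q$, where $f:\mathbb{R}^n\to\mathbb{R}$ and $g_j=(g_{j,0},\widehat{g}_j):\mathbb{R}^n\to\mathbb{R}^{m_j}$ are continuously differentiable and $m_j\ge 2$ for all $j$. $D$ denotes the Jacobian matrix. For feasible $x$: $I_0(x)=\{j: g_j(x)=0\}$, $I_B(x)=\{j: g_j(x)\in\mathrm{bd}_+\mathbb{L}_{m_j}\}$.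 Lagrangian: $L(x,\mu_1,\dots,\mu_q)=f(x)-\sum_{j=1}^q\langle\mu_j,g_j(x)\rangle$. A feasible $\bar{x}$ satisfies the KKT conditions if there exist $\bar{\mu}_j\in\mathbb{L}_{m_j}$ with $\nabla_xL(\bar{x},\bar{\mu}_1,\dots,\bar{\mu}_q)=0$ and $\langle\bar{\mu}_j,g_j(\bar{x})\rangle=0$ for all $j\in\{1,\dots,q\}$. Eigenvectors: for $y\in\mathbb{R}^m$, $u_1(y)=\frac12(1,-w)$ and $u_2(y)=\frac12(1,w)$, where $w=\widehat{y}/\|\widehat{y}\|$ if $\widehat{y}\ne0$, and $w\in\mathbb{R}^{m-1}$ is any unit vector (free choice, the same $w$ for $u_1$ and $u_2$) if $\widehat{y}=0$. For index sets $J_B,J_-,J_+\subseteq\{1,\dots,q\}$ with $\widehat{g}_j(x)\neq0$ for $j\in J_B$, and $w=[w_j]_{j\in J_-\cup J_+}$, let $\mathcal{D}_{J_B,J_-,J_+}(x,w)$ be the (indexed) family of vectors $$\left\{Dg_{j}(x)^\top u_1(g_j(x))\right\}_{j\in J_B}\cup\left\{Dg_{j}(x)^\top (1,-w_j)\right\}_{j\in J_-}\cup\left\{Dg_{j}(x)^\top (1,w_j)\right\}_{j\in J_{+}}.$$ A finite (indexed) family of vectors is positively linearly dependent if some linear combination of it with nonnegative coefficients, not all zero, vanishes. Weak-CPLD holds at a feasible $\bar{x}$ if: for every sequence $x^k\to\bar{x}$ in $\mathbb{R}^n$ there exist an infinite set $I\subseteq\mathbb{N}$ and (a choice of) eigenvectors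 $u_1(g_j(x^k))=\frac12(1,-w_j^k)$, $u_2(g_j(x^k))=\frac12(1,w_j^k)$, $k\in I$, $j\in I_0(\bar{x})$, converging along $k\in I$ to $\frac12(1,-\bar{w}_j)$ and $\frac12(1,\bar{w}_j)$, respectively, with $\|\bar{w}_j\|=1$, such that for all subsets $J_B\subseteq I_B(\bar{x})$ and $J_-,J_+\subseteq I_0(\bar{x})$: if $\mathcal{D}_{J_B,J_-,J_+}(\bar{x},\bar{w})$ is positively linearly dependent, then $\mathcal{D}_{J_B,J_-,J_+}(x^k,w^k)$ is linearly dependent for all sufficiently large $k\in I$, where $\bar{w}=[\bar{w}_j]_{j\in J_-\cup J_+}$ and $w^k=[w_j^k]_{j\in J_-\cup J_+}$. *)

theory Defs
  imports "HOL-Analysis.Analysis"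
begin

text \<open>
  The dimensions \<open>m\<^sub>j\<close> vary with \<open>j\<close>, so \<open>\<real>\<^sup>m\<close> is the carrier
  \<open>topspace (Euclidean_space m)\<close> of the library, i.e. the functions \<open>nat \<Rightarrow> real\<close> that vanish from
  index \<open>m\<close> on. A vector \<open>y = (y\<^sub>0, tail y)\<close> of \<open>\<real>\<^sup>m\<close> is \<open>case_nat y\<^sub>0 (tail y)\<close>, where the tail lives
  in \<open>Rn (m - 1)\<close>.
\<close>

abbreviation Rn :: "nat \<Rightarrow> (nat \<Rightarrow> real) set" where
  "Rn m \<equiv> topspace (Euclidean_space m)"

definition enorm :: "nat \<Rightarrow> (nat \<Rightarrow> real) \<Rightarrow> real" where
  "enorm m y = L2_set y {..<m}"

definition einner :: "nat \<Rightarrow> (nat \<Rightarrow> real) \<Rightarrow> (nat \<Rightarrow> real) \<Rightarrow> real" where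
  "einner m y z = (\<Sum>i<m. y i * z i)"

definition tail :: "(nat \<Rightarrow> real) \<Rightarrow> nat \<Rightarrow> real" where
  "tail y = (\<lambda>i. y (Suc i))"

definition soc :: "nat \<Rightarrow> (nat \<Rightarrow> real) set" where
  "soc m = {y \<in> Rn m. enorm (m - 1) (tail y) \<le> y 0}"

definition bd_plus :: "nat \<Rightarrow> (nat \<Rightarrow> real) set" where
  "bd_plus m = (Euclidean_space m frontier_of soc m) - {\<lambda>_. 0}"

text \<open>The counterpart of the library's \<open>closest_point\<close>, which needs a type class for the space.\<close>

definition eproj :: "nat \<Rightarrow> (nat \<Rightarrow> real) set \<Rightarrow> (nat \<Rightarrow> real) \<Rightarrow> nat \<Rightarrow> real" where
  "eproj m C y = (SOME z. z \<in> C \<and>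
     (\<forall>v\<in>C. enorm m (\<lambda>i. y i - z i) \<le> enorm m (\<lambda>i. y i - v i)))"

definition grad :: "('a::real_inner \<Rightarrow> real) \<Rightarrow> 'a \<Rightarrow> 'a" where
  "grad h x = (THE D. GDERIV h x :> D)"

definition C1 :: "('a::real_inner \<Rightarrow> real) \<Rightarrow> bool" where
  "C1 h \<longleftrightarrow> (\<exists>h'. (\<forall>x. GDERIV h x :> h' x) \<and> continuous_on UNIV h')"

definition C1_map :: "nat \<Rightarrow> ('a::real_inner \<Rightarrow> nat \<Rightarrow> real) \<Rightarrow> bool" where
  "C1_map m h \<longleftrightarrow> (\<forall>x. h x \<in> Rn m) \<and> (\<forall>i<m. C1 (\<lambda>x. h x i))"

text \<open>Row \<open>i\<close> of the Jacobian matrix of \<open>h\<close> at \<open>x\<close>, and the product of the transposed Jacobian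
  with \<open>v \<in> \<real>\<^sup>m\<close>.\<close>

definition jac :: "('a::real_inner \<Rightarrow> nat \<Rightarrow> real) \<Rightarrow> 'a \<Rightarrow> nat \<Rightarrow> 'a" where
  "jac h x i = grad (\<lambda>z. h z i) x"

definition jac_transp :: "nat \<Rightarrow> ('a::real_inner \<Rightarrow> nat \<Rightarrow> real) \<Rightarrow> 'a \<Rightarrow> (nat \<Rightarrow> real) \<Rightarrow> 'a" where
  "jac_transp m h x v = (\<Sum>i<m. v i *\<^sub>R jac h x i)"

definition feasible :: "nat \<Rightarrow> (nat \<Rightarrow> nat) \<Rightarrow> (nat \<Rightarrow> 'a \<Rightarrow> nat \<Rightarrow> real) \<Rightarrow> 'a set" where
  "feasible q m g = {x. \<forall>j\<in>{1..q}. g j x \<in> soc (m j)}"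

definition local_minimizer ::
  "nat \<Rightarrow> (nat \<Rightarrow> nat) \<Rightarrow> ('a::metric_space \<Rightarrow> real) \<Rightarrow> (nat \<Rightarrow> 'a \<Rightarrow> nat \<Rightarrow> real) \<Rightarrow> 'a \<Rightarrow> bool" where
  "local_minimizer q m f g x \<longleftrightarrow> x \<in> feasible q m g \<and>
     (\<exists>e>0. \<forall>y \<in> feasible q m g \<inter> ball x e. f x \<le> f y)"

definition I0 :: "nat \<Rightarrow> (nat \<Rightarrow> 'a \<Rightarrow> nat \<Rightarrow> real) \<Rightarrow> 'a \<Rightarrow> nat set" where
  "I0 q g x = {j \<in> {1..q}. g j x = (\<lambda>_. 0)}"

definition IB :: "nat \<Rightarrow> (nat \<Rightarrow> nat) \<Rightarrow> (nat \<Rightarrow> 'a \<Rightarrow> nat \<Rightarrow> real) \<Rightarrow> 'a \<Rightarrow> nat set" where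
  "IB q m g x = {j \<in> {1..q}. g j x \<in> bd_plus (m j)}"

definition lagrangian ::
  "nat \<Rightarrow> (nat \<Rightarrow> nat) \<Rightarrow> ('a \<Rightarrow> real) \<Rightarrow> (nat \<Rightarrow> 'a \<Rightarrow> nat \<Rightarrow> real) \<Rightarrow> 'a \<Rightarrow> (nat \<Rightarrow> nat \<Rightarrow> real) \<Rightarrow> real" where
  "lagrangian q m f g x \<mu> = f x - (\<Sum>j=1..q. einner (m j) (\<mu> j) (g j x))"

definition KKT ::
  "nat \<Rightarrow> (nat \<Rightarrow> nat) \<Rightarrow> ('a::real_inner \<Rightarrow> real) \<Rightarrow> (nat \<Rightarrow> 'a \<Rightarrow> nat \<Rightarrow> real) \<Rightarrow> 'a \<Rightarrow> bool" where
  "KKT q m f g x \<longleftrightarrow> x \<in> feasible q m g \<and>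
     (\<exists>\<mu>. (\<forall>j\<in>{1..q}. \<mu> j \<in> soc (m j)) \<and>
          grad (\<lambda>z. lagrangian q m f g z \<mu>) x = 0 \<and>
          (\<forall>j\<in>{1..q}. einner (m j) (\<mu> j) (g j x) = 0))"

text \<open>The admissible directions \<open>w\<close> in the eigenvectors of \<open>y \<in> \<real>\<^sup>m\<close>.\<close>

definition eig_dirs :: "nat \<Rightarrow> (nat \<Rightarrow> real) \<Rightarrow> (nat \<Rightarrow> real) set" where
  "eig_dirs m y =
     (if tail y = (\<lambda>_. 0) then {w \<in> Rn (m - 1). enorm (m - 1) w = 1}
      else {\<lambda>i. tail y i / enorm (m - 1) (tail y)})"

definition u1 :: "(nat \<Rightarrow> real) \<Rightarrow> nat \<Rightarrow> real" where
  "u1 w = (\<lambda>i. 1/2 * case_nat 1 (\<lambda>l. - w l) i)"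

definition u2 :: "(nat \<Rightarrow> real) \<Rightarrow> nat \<Rightarrow> real" where
  "u2 w = (\<lambda>i. 1/2 * case_nat 1 w i)"

text \<open>Indexed families \<open>(v i)\<close>, \<open>i \<in> A\<close>: repeated vectors count as dependent, unlike with the
  set-based library constant \<open>dependent\<close>.\<close>

definition fam_lin_dep :: "'i set \<Rightarrow> ('i \<Rightarrow> 'a::real_vector) \<Rightarrow> bool" where
  "fam_lin_dep A v \<longleftrightarrow> (\<exists>c. (\<exists>i\<in>A. c i \<noteq> 0) \<and> (\<Sum>i\<in>A. c i *\<^sub>R v i) = 0)"

definition fam_pos_lin_dep :: "'i set \<Rightarrow> ('i \<Rightarrow> 'a::real_vector) \<Rightarrow> bool" where
  "fam_pos_lin_dep A v \<longleftrightarrow>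
     (\<exists>c. (\<forall>i\<in>A. c i \<ge> 0) \<and> (\<exists>i\<in>A. c i \<noteq> 0) \<and> (\<Sum>i\<in>A. c i *\<^sub>R v i) = 0)"

text \<open>
  The family \<open>\<D>\<close> for \<open>JB\<close>, \<open>Jm\<close>, \<open>Jp\<close> at \<open>(x, w)\<close> is indexed by the disjoint sum
  \<open>JB <+> Jm <+> Jp\<close>. In its first part the tail of \<open>g j x\<close> is meant to be nonzero, so
  that the direction is determined; for \<open>j \<in> IB q m g xbar\<close> this holds at all \<open>x\<close> near \<open>xbar\<close>.
\<close>

definition Dfam ::
  "(nat \<Rightarrow> nat) \<Rightarrow> (nat \<Rightarrow> 'a::real_inner \<Rightarrow> nat \<Rightarrow> real) \<Rightarrow> 'a \<Rightarrow> (nat \<Rightarrow> nat \<Rightarrow> real) \<Rightarrow>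
   nat + nat + nat \<Rightarrow> 'a" where
  "Dfam m g x w = case_sum
     (\<lambda>j. jac_transp (m j) (g j) x
            (u1 (\<lambda>i. tail (g j x) i / enorm (m j - 1) (tail (g j x)))))
     (case_sum
       (\<lambda>j. jac_transp (m j) (g j) x (case_nat 1 (\<lambda>i. - w j i)))
       (\<lambda>j. jac_transp (m j) (g j) x (case_nat 1 (w j))))"

definition along :: "nat set \<Rightarrow> nat filter" where
  "along I = inf sequentially (principal I)"

definition weak_CPLD ::
  "nat \<Rightarrow> (nat \<Rightarrow> nat) \<Rightarrow> (nat \<Rightarrow> 'a::real_inner \<Rightarrow> nat \<Rightarrow> real) \<Rightarrow> 'a \<Rightarrow> bool" where
  "weak_CPLD q m g xbar \<longleftrightarrow> (\<forall>x. x \<longlonglongrightarrow> xbar \<longrightarrow>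
     (\<exists>I w wbar. infinite I \<and>
        (\<forall>k\<in>I. \<forall>j\<in>I0 q g xbar. w k j \<in> eig_dirs (m j) (g j (x k))) \<and>
        (\<forall>j\<in>I0 q g xbar.
           wbar j \<in> Rn (m j - 1) \<and> enorm (m j - 1) (wbar j) = 1 \<and>
           limitin (Euclidean_space (m j)) (\<lambda>k. u1 (w k j)) (u1 (wbar j)) (along I) \<and>
           limitin (Euclidean_space (m j)) (\<lambda>k. u2 (w k j)) (u2 (wbar j)) (along I)) \<and>
        (\<forall>JB Jm Jp. JB \<subseteq> IB q m g xbar \<longrightarrow> Jm \<subseteq> I0 q g xbar \<longrightarrow> Jp \<subseteq> I0 q g xbar \<longrightarrow>
           fam_pos_lin_dep (JB <+> Jm <+> Jp) (Dfam m g xbar wbar) \<longrightarrow>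
           (\<forall>\<^sub>F k in along I. fam_lin_dep (JB <+> Jm <+> Jp) (Dfam m g (x k) (w k))))))"

end

theory Submission
  imports Defs
begin

text \<open>
  The heart of the matter is the first claim. The projection \<open>P\<close> of \<open>- g\<^sub>j(x\<^sup>k)\<close> onto the cone is
  a nonnegative combination of the eigenvectors of \<open>g\<^sub>j(x\<^sup>k)\<close>, weighted by the negative parts of the
  eigenvalues. Near the feasible limit this leaves nothing for strictly feasible constraints, only
  \<open>u\<^sub>1\<close> for constraints on the boundary, and both eigenvectors for constraints at the vertex. Hence
  \<open>\<nabla>f(x\<^sup>k)\<close> is, up to an error tending to zero, a conic combination of the family \<open>\<D>\<close> at
  \<open>(x\<^sup>k, w\<^sup>k)\<close> (\<open>eventually_penalty_gradient\<close>). Its coefficients may be unbounded as \<open>\<rho>\<^sub>k \<rightarrow> \<infinity>\<close>.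

  By Caratheodory's theorem (\<open>conic_caratheodory_family\<close>) the combination can be taken over a linearly
  independent subfamily, and by the pigeonhole principle over the same index set for infinitely many
  \<open>k\<close>. Were the corresponding subfamily at the limit \<open>(xbar, wbar)\<close> positively dependent, weak-CPLD would
  make the subfamilies at \<open>x\<^sup>k\<close> dependent. So it is not, and then the cones it generates behave
  continuously (\<open>limit_in_cone\<close>): \<open>\<nabla>f\<close> at the limit is a conic combination of the limit family.
  Reading off its coefficients as eigenvalues gives multipliers (\<open>KKT_from_family\<close>).

  For a local minimizer, sequences as in the first claim arise from minimizing
  \<open>f + \<parallel>x - a\<parallel>\<^sup>2/2 + (\<rho>\<^sub>k/2) \<Sum>\<^sub>j \<parallel>P(- g\<^sub>j(x))\<parallel>\<^sup>2\<close> over a small ball around \<open>a\<close>. Stationarity of the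
  minimizers is obtained by comparison with a smooth majorant (\<open>merit_minimizer_stationary\<close>).
\<close>

section \<open>Cones generated by finite families\<close>

text \<open>
  Caratheodory's theorem for cones: as long as the family is dependent, moving the coefficients
  along a dependence until the first of them vanishes removes an index without changing the sum.
\<close>

lemma conic_caratheodory_family:
  fixes v :: "'i \<Rightarrow> 'a::real_vector"
  assumes "finite A" and "\<And>i. i \<in> A \<Longrightarrow> 0 \<le> c i"
  obtains B d where "B \<subseteq> A" "\<And>i. i \<in> B \<Longrightarrow> 0 \<le> d i" "\<not> fam_lin_dep B v"
    "(\<Sum>i\<in>B. d i *\<^sub>R v i) = (\<Sum>i\<in>A. c i *\<^sub>R v i)"
proof -
  have "\<exists>B d. B \<subseteq> A \<and> (\<forall>i\<in>B. 0 \<le> d i) \<and> \<not> fam_lin_dep B v \<and>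
          (\<Sum>i\<in>B. d i *\<^sub>R v i) = (\<Sum>i\<in>A. c i *\<^sub>R v i)"
    using assms
  proof (induction A arbitrary: c rule: finite_psubset_induct)
    case (psubset A)
    show ?case
    proof (cases "fam_lin_dep A v")
      case False
      with psubset.prems show ?thesis by (intro exI[of _ A] exI[of _ c]) auto
    next
      case True
      then obtain e0 where e0: "\<exists>i\<in>A. e0 i \<noteq> 0" "(\<Sum>i\<in>A. e0 i *\<^sub>R v i) = 0"
        unfolding fam_lin_dep_def by blast
      obtain e where e: "\<exists>i\<in>A. e i > (0::real)" "(\<Sum>i\<in>A. e i *\<^sub>R v i) = 0"
      proof (cases "\<exists>i\<in>A. e0 i > 0")
        case True
        with e0 that show ?thesis by blast
      next
        case False
        with e0(1) have "\<exists>i\<in>A. - e0 i > 0"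
          by (metis neg_0_less_iff_less linorder_neqE_linordered_idom)
        moreover have "(\<Sum>i\<in>A. (- e0 i) *\<^sub>R v i) = 0"
          unfolding scaleR_minus_left sum_negf e0(2) by simp
        ultimately show ?thesis by (rule that)
      qed
      define P where "P = {i\<in>A. e i > 0}"
      have P: "finite P" "P \<noteq> {}" using e(1) psubset.hyps by (auto simp: P_def)
      \<comment> \<open>The ratio test: the largest step along \<open>- e\<close> that keeps the coefficients nonnegative.\<close>
      define t where "t = Min ((\<lambda>i. c i / e i) ` P)"
      obtain i0 where i0: "i0 \<in> P" "t = c i0 / e i0"
        using Min_in[of "(\<lambda>i. c i / e i) ` P"] P(1) P(2) that unfolding t_def by blast
      have tle: "t \<le> c i / e i" if "i \<in> P" for i
        using that P by (simp add: t_def)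
      have i0A: "i0 \<in> A" "e i0 > 0" using i0 by (auto simp: P_def)
      have t0: "0 \<le> t" using i0 i0A psubset.prems by simp
      have nonneg: "0 \<le> c i - t * e i" if "i \<in> A" for i
      proof (cases "e i > 0")
        case True
        then have "t * e i \<le> c i" using tle[of i] that by (simp add: P_def field_simps)
        then show ?thesis by simp
      next
        case False
        then have "t * e i \<le> 0" using t0 by (simp add: mult_nonneg_nonpos)
        then show ?thesis using psubset.prems[OF that] by linarith
      qed
      have zero: "c i0 - t * e i0 = 0" using i0 i0A by simp
      have "(\<Sum>i\<in>A - {i0}. (c i - t * e i) *\<^sub>R v i) = (\<Sum>i\<in>A. (c i - t * e i) *\<^sub>R v i)"
        using zero i0A psubset.hyps by (simp add: sum.remove)
      also have "\<dots> = (\<Sum>i\<in>A. c i *\<^sub>R v i) - t *\<^sub>R (\<Sum>i\<in>A. e i *\<^sub>R v i)"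
        by (simp add: scaleR_diff_left sum_subtractf scaleR_sum_right)
      finally have eq: "(\<Sum>i\<in>A - {i0}. (c i - t * e i) *\<^sub>R v i) = (\<Sum>i\<in>A. c i *\<^sub>R v i)"
        using e(2) by simp
      have "A - {i0} \<subset> A" using i0A by auto
      from psubset.IH[OF this, of "\<lambda>i. c i - t * e i"] nonneg
      obtain B d where "B \<subseteq> A - {i0}" "\<forall>i\<in>B. 0 \<le> d i" "\<not> fam_lin_dep B v"
        "(\<Sum>i\<in>B. d i *\<^sub>R v i) = (\<Sum>i\<in>A - {i0}. (c i - t * e i) *\<^sub>R v i)"
        by auto
      with eq show ?thesis by (intro exI[of _ B] exI[of _ d]) auto
    qed
  qed
  then show thesis using that by blast
qed

lemma bounded_family_convergent_subsequence:
  fixes d :: "nat \<Rightarrow> 'i \<Rightarrow> real"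
  assumes "finite A" and "\<And>i k. i \<in> A \<Longrightarrow> \<bar>d k i\<bar> \<le> M"
  obtains r l where "strict_mono (r :: nat \<Rightarrow> nat)" "\<And>i. i \<in> A \<Longrightarrow> (\<lambda>k. d (r k) i) \<longlonglongrightarrow> l i"
proof -
  have "\<exists>r l. strict_mono (r :: nat \<Rightarrow> nat) \<and> (\<forall>i\<in>A. (\<lambda>k. d (r k) i) \<longlonglongrightarrow> l i)"
    using assms
  proof (induction A rule: finite_induct)
    case empty
    show ?case by (intro exI[of _ id]) (simp add: strict_mono_def)
  next
    case (insert a A)
    then obtain r l where r: "strict_mono (r :: nat \<Rightarrow> nat)" "\<forall>i\<in>A. (\<lambda>k. d (r k) i) \<longlonglongrightarrow> l i"
      by auto
    have "bounded (range (\<lambda>k. d (r k) a))"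
      using insert.prems by (auto simp: bounded_iff)
    then obtain b s where s: "strict_mono (s :: nat \<Rightarrow> nat)" "((\<lambda>k. d (r k) a) \<circ> s) \<longlonglongrightarrow> b"
      using bounded_imp_convergent_subsequence by blast
    have "(\<lambda>k. d ((r \<circ> s) k) i) \<longlonglongrightarrow> l i" if "i \<in> A" for i
      using LIMSEQ_subseq_LIMSEQ[OF r(2)[rule_format, OF that] s(1)] by (simp add: o_def)
    moreover have "(\<lambda>k. d ((r \<circ> s) k) a) \<longlonglongrightarrow> b" using s(2) by (simp add: o_def)
    ultimately have "\<forall>i\<in>insert a A. (\<lambda>k. d ((r \<circ> s) k) i) \<longlonglongrightarrow> (l(a := b)) i"
      using insert.hyps by auto
    moreover have "strict_mono (r \<circ> s)" using r(1) s(1) by (rule strict_mono_o)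
    ultimately show ?case by blast
  qed
  then show thesis using that by blast
qed

text \<open>
  The limit of points of varying cones lies in the limit cone, even though the coefficients are not
  assumed to be bounded. Instead of extracting a subsequence from the coefficients \<open>c\<close>, the total
  mass of \<open>(1, c)\<close> is scaled to one, which makes everything bounded. The limit of the scaled first
  entry cannot be zero: the scaled \<open>c\<close> would then converge to a nonnegative nonzero
  dependence of the limit family. Dividing by it recovers coefficients for \<open>b\<close>.
\<close>

lemma limit_in_cone:
  fixes v :: "nat \<Rightarrow> 'i \<Rightarrow> 'a::real_normed_vector"
  assumes fin: "finite A"
    and v: "\<And>i. i \<in> A \<Longrightarrow> (\<lambda>k. v k i) \<longlonglongrightarrow> vbar i"
    and c: "\<And>k i. i \<in> A \<Longrightarrow> 0 \<le> c k i"
    and b: "(\<lambda>k. \<Sum>i\<in>A. c k i *\<^sub>R v k i) \<longlonglongrightarrow> b"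
    and indep: "\<not> fam_pos_lin_dep A vbar"
  obtains d where "\<And>i. i \<in> A \<Longrightarrow> 0 \<le> d i" "(\<Sum>i\<in>A. d i *\<^sub>R vbar i) = b"
proof -
  define N where "N k = (\<Sum>i\<in>A. c k i)" for k
  have N0: "0 \<le> N k" for k using c by (simp add: N_def sum_nonneg)
  have cN: "c k i \<le> N k" if "i \<in> A" for k i
    unfolding N_def using that fin c by (intro member_le_sum) auto
  define p where "p k io = (case io of None \<Rightarrow> 1 / (1 + N k) | Some i \<Rightarrow> c k i / (1 + N k))"
    for k and io :: "'i option"
  \<comment> \<open>The index \<open>None\<close> carries the scaling factor itself.\<close>
  have p_bounds: "0 \<le> p k io \<and> p k io \<le> 1" if "io \<in> insert None (Some ` A)" for k io
    using that N0[of k] c[of _ k] cN[of _ k]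
    by (auto simp: p_def field_simps intro: order_trans[OF cN] split: option.splits)
  then have "\<bar>p k io\<bar> \<le> 1" if "io \<in> insert None (Some ` A)" for k io
    using that by auto
  then obtain r l where r: "strict_mono (r :: nat \<Rightarrow> nat)"
    and l: "\<And>io. io \<in> insert None (Some ` A) \<Longrightarrow> (\<lambda>k. p (r k) io) \<longlonglongrightarrow> l io"
    using bounded_family_convergent_subsequence[of "insert None (Some ` A)" p 1] fin by blast
  have l0: "0 \<le> l io" if "io \<in> insert None (Some ` A)" for io
    by (rule LIMSEQ_le_const[OF l[OF that]]) (use p_bounds that in blast)
  have "p k None + (\<Sum>i\<in>A. p k (Some i)) = 1" for k
  proof -
    have "(\<Sum>i\<in>A. p k (Some i)) = N k / (1 + N k)"
      by (simp add: p_def flip: sum_divide_distrib N_def)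
    then have "p k None + (\<Sum>i\<in>A. p k (Some i)) = (1 + N k) / (1 + N k)"
      unfolding add_divide_distrib by (simp add: p_def)
    then show ?thesis using N0[of k] by simp
  qed
  moreover have "(\<lambda>k. p (r k) None + (\<Sum>i\<in>A. p (r k) (Some i))) \<longlonglongrightarrow> l None + (\<Sum>i\<in>A. l (Some i))"
    by (intro tendsto_intros l) auto
  ultimately have l_sum: "l None + (\<Sum>i\<in>A. l (Some i)) = 1"
    using LIMSEQ_unique[OF _ tendsto_const] by fastforce
  have "(\<Sum>i\<in>A. p k (Some i) *\<^sub>R v k i) = p k None *\<^sub>R (\<Sum>i\<in>A. c k i *\<^sub>R v k i)" for k
    by (simp add: p_def scaleR_sum_right field_simps)
  moreover have "(\<lambda>k. \<Sum>i\<in>A. p (r k) (Some i) *\<^sub>R v (r k) i) \<longlonglongrightarrow> (\<Sum>i\<in>A. l (Some i) *\<^sub>R vbar i)"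
    by (intro tendsto_intros l LIMSEQ_subseq_LIMSEQ[OF v r, unfolded o_def]) auto
  moreover have "(\<lambda>k. p (r k) None *\<^sub>R (\<Sum>i\<in>A. c (r k) i *\<^sub>R v (r k) i)) \<longlonglongrightarrow> l None *\<^sub>R b"
    by (intro tendsto_intros l LIMSEQ_subseq_LIMSEQ[OF b r, unfolded o_def]) auto
  ultimately have lim: "(\<Sum>i\<in>A. l (Some i) *\<^sub>R vbar i) = l None *\<^sub>R b"
    using LIMSEQ_unique by simp
  have "l None \<noteq> 0"
  proof
    assume z: "l None = 0"
    with l_sum have "\<exists>i\<in>A. l (Some i) \<noteq> 0" by (metis add_0 sum.neutral zero_neq_one)
    then have "fam_pos_lin_dep A vbar"
      unfolding fam_pos_lin_dep_def using l0 lim z by (intro exI[of _ "\<lambda>i. l (Some i)"]) auto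
    with indep show False ..
  qed
  show thesis
  proof
    show "0 \<le> l (Some i) / l None" if "i \<in> A" for i using l0 that by simp
    have "(\<Sum>i\<in>A. (l (Some i) / l None) *\<^sub>R vbar i) = inverse (l None) *\<^sub>R (\<Sum>i\<in>A. l (Some i) *\<^sub>R vbar i)"
      by (simp add: scaleR_sum_right divide_inverse_commute)
    then show "(\<Sum>i\<in>A. (l (Some i) / l None) *\<^sub>R vbar i) = b"
      using lim \<open>l None \<noteq> 0\<close> by simp
  qed
qed

section \<open>Spectral decomposition and projection onto the second-order cone\<close>

text \<open>
  The vector with eigenvalues \<open>a\<close>, \<open>b\<close> in the eigenvectors of direction \<open>w\<close>. All vectors that
  occur below (constraint values, projections, multipliers) have this form with a common \<open>w\<close>, so
  that membership in the cone and inner products become statements about two numbers.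
\<close>

definition spectral :: "(nat \<Rightarrow> real) \<Rightarrow> real \<Rightarrow> real \<Rightarrow> nat \<Rightarrow> real" where
  "spectral w a b = (\<lambda>i. a * u1 w i + b * u2 w i)"

lemma spectral_0: "spectral w a b 0 = (a + b) / 2"
  by (simp add: spectral_def u1_def u2_def)

lemma tail_spectral: "tail (spectral w a b) = (\<lambda>i. (b - a) / 2 * w i)"
  by (auto simp: spectral_def u1_def u2_def tail_def field_simps)

lemma tail_nth: "tail y l = y (Suc l)"
  by (simp add: tail_def)

lemma Rn_iff_tail: "0 < m \<Longrightarrow> y \<in> Rn m \<longleftrightarrow> tail y \<in> Rn (m - 1)"
  by (cases m) (auto simp: topspace_Euclidean_space tail_def dest: Suc_le_D)

lemma einner_split:
  assumes "0 < m"
  shows "einner m y z = y 0 * z 0 + einner (m - 1) (tail y) (tail z)"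
  using assms by (cases m) (simp_all add: einner_def tail_def sum.lessThan_Suc_shift del: sum.lessThan_Suc)

lemma enorm_power2: "(enorm m y)\<^sup>2 = einner m y y"
  by (simp add: enorm_def L2_set_def einner_def sum_nonneg power2_eq_square)

lemma enorm_nonneg: "0 \<le> enorm m y"
  by (simp add: enorm_def)

lemma enorm_scale: "enorm m (\<lambda>i. t * y i) = \<bar>t\<bar> * enorm m y"
  by (simp add: enorm_def L2_set_def power_mult_distrib real_sqrt_mult flip: sum_distrib_left)

lemma einner_ge_minus_enorm: "- (enorm m y * enorm m z) \<le> einner m y z"
proof -
  have "\<bar>einner m y z\<bar> \<le> (\<Sum>i<m. \<bar>y i\<bar> * \<bar>z i\<bar>)"
    unfolding einner_def by (rule order_trans[OF sum_abs]) (simp add: abs_mult)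
  also have "\<dots> \<le> enorm m y * enorm m z"
    unfolding enorm_def by (rule L2_set_mult_ineq)
  finally show ?thesis by linarith
qed

text \<open>
  Half of the self-duality of the cone; the tails are handled by the Cauchy-Schwarz inequality.
\<close>

lemma einner_soc_nonneg:
  assumes "0 < m" "y \<in> soc m" "z \<in> soc m"
  shows "0 \<le> einner m y z"
proof -
  have "enorm (m - 1) (tail y) * enorm (m - 1) (tail z) \<le> y 0 * z 0"
    using assms enorm_nonneg by (intro mult_mono) (auto simp: soc_def intro: order_trans)
  then show ?thesis
    using einner_ge_minus_enorm[of "m - 1" "tail y" "tail z"] unfolding einner_split[OF assms(1)]
    by linarith
qed

context
  fixes m :: nat and w :: "nat \<Rightarrow> real"
  assumes m: "0 < m" and w: "w \<in> Rn (m - 1)" "enorm (m - 1) w = 1"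
begin

lemma einner_spectral: "einner m (spectral w a b) (spectral w c d) = (a * c + b * d) / 2"
proof -
  have "einner (m - 1) w w = 1" using enorm_power2[of "m - 1" w] w by simp
  then have "einner (m - 1) (\<lambda>i. s * w i) (\<lambda>i. t * w i) = s * t" for s t
    by (simp add: einner_def mult.assoc mult.left_commute[of _ t] flip: sum_distrib_left)
  then show ?thesis
    unfolding einner_split[OF m] spectral_0 tail_spectral by (simp only:) (simp add: field_simps)
qed

lemma spectral_in_soc:
  assumes "0 \<le> a" "0 \<le> b"
  shows "spectral w a b \<in> soc m"
proof -
  have "spectral w a b \<in> Rn m"
    unfolding Rn_iff_tail[OF m] tail_spectral using w(1) by (simp add: topspace_Euclidean_space)
  then show ?thesis using assms
    unfolding soc_def mem_Collect_eq tail_spectral enorm_scale w(2) spectral_0 by simp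
qed

end

lemma enorm_pos: "y \<in> Rn m \<Longrightarrow> y \<noteq> (\<lambda>_. 0) \<Longrightarrow> 0 < enorm m y"
proof -
  assume y: "y \<in> Rn m" "y \<noteq> (\<lambda>_. 0)"
  then obtain i where "y i \<noteq> 0" by auto
  moreover with y(1) have "i < m" unfolding topspace_Euclidean_space by (auto intro: leI simp: not_less[symmetric])
  ultimately have "enorm m y \<noteq> 0" by (auto simp: enorm_def L2_set_eq_0_iff)
  then show ?thesis using enorm_nonneg[of m y] by simp
qed

lemma eig_dirs_unit:
  assumes "0 < m" "y \<in> Rn m" "w \<in> eig_dirs m y"
  shows "w \<in> Rn (m - 1)" "enorm (m - 1) w = 1"
proof -
  have ty: "tail y \<in> Rn (m - 1)" using assms Rn_iff_tail by blast
  have "w \<in> Rn (m - 1) \<and> enorm (m - 1) w = 1"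
  proof (cases "tail y = (\<lambda>_. 0)")
    case False
    then have pos: "0 < enorm (m - 1) (tail y)" using ty enorm_pos by blast
    have w: "w = (\<lambda>i. inverse (enorm (m - 1) (tail y)) * tail y i)"
      using assms False by (simp add: eig_dirs_def divide_inverse_commute)
    have "enorm (m - 1) w = 1"
      unfolding w enorm_scale using pos by simp
    then show ?thesis using ty by (auto simp: w topspace_Euclidean_space)
  qed (use assms in \<open>simp add: eig_dirs_def\<close>)
  then show "w \<in> Rn (m - 1)" "enorm (m - 1) w = 1" by auto
qed

lemma eig_dirs_nonempty:
  assumes "2 \<le> m"
  shows "eig_dirs m y \<noteq> {}"
proof -
  let ?e = "\<lambda>i. if i = 0 then 1 else 0 :: real"
  have "?e \<in> Rn (m - 1)" using assms by (auto simp: topspace_Euclidean_space)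
  moreover have "(enorm (m - 1) ?e)\<^sup>2 = 1"
    unfolding enorm_power2 using assms by (simp add: einner_def if_distrib[of "\<lambda>x. x * _"] cong: if_cong)
  then have "enorm (m - 1) ?e = 1" using enorm_nonneg[of "m - 1" ?e] by (simp add: power2_eq_1_iff)
  ultimately show ?thesis by (auto simp: eig_dirs_def)
qed

lemma spectral_decomposition:
  assumes "0 < m" "y \<in> Rn m" "w \<in> eig_dirs m y"
  shows "y = spectral w (y 0 - enorm (m - 1) (tail y)) (y 0 + enorm (m - 1) (tail y))"
proof
  fix i
  show "y i = spectral w (y 0 - enorm (m - 1) (tail y)) (y 0 + enorm (m - 1) (tail y)) i"
  proof (cases i)
    case 0
    then show ?thesis by (simp add: spectral_0)
  next
    case (Suc l)
    let ?n = "enorm (m - 1) (tail y)"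
    have "tail y l = ?n * w l"
    proof (cases "tail y = (\<lambda>_. 0)")
      case True
      then show ?thesis by (simp add: enorm_def L2_set_def)
    next
      case False
      then have "0 < ?n" using assms Rn_iff_tail enorm_pos by blast
      then show ?thesis using assms False by (simp add: eig_dirs_def)
    qed
    then show ?thesis
      using fun_cong[OF tail_spectral[of w "y 0 - ?n" "y 0 + ?n"], of l] by (simp add: Suc tail_def)
  qed
qed

text \<open>
  The negative parts of the eigenvalues \<open>y\<^sub>0 - \<parallel>tail y\<parallel>\<close> and \<open>y\<^sub>0 + \<parallel>tail y\<parallel>\<close> of \<open>y\<close>, that is the
  eigenvalues of the projection of \<open>- y\<close>. They do not depend on the choice of a direction.
\<close>

definition neg_eig1 :: "nat \<Rightarrow> (nat \<Rightarrow> real) \<Rightarrow> real" where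
  "neg_eig1 m y = max 0 (enorm (m - 1) (tail y) - y 0)"

definition neg_eig2 :: "nat \<Rightarrow> (nat \<Rightarrow> real) \<Rightarrow> real" where
  "neg_eig2 m y = max 0 (- y 0 - enorm (m - 1) (tail y))"

lemma enorm_diff_power2:
  "(enorm m (\<lambda>i. y i - z i))\<^sup>2 = (enorm m y)\<^sup>2 - 2 * einner m y z + (enorm m z)\<^sup>2"
  by (simp add: enorm_power2 einner_def sum_distrib_left algebra_simps flip: sum.distrib sum_subtractf)

text \<open>
  Moreau's criterion: \<open>- y = P - S\<close> with \<open>P\<close> and \<open>S\<close> orthogonal elements of a self-dual cone
  exhibits \<open>P\<close> as the projection. The estimate behind it also bounds \<open>\<parallel>P - v\<parallel>\<close>, which gives the
  uniqueness needed to evaluate the choice operator in the definition of the projection.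
\<close>

lemma eproj_neg_moreau:
  assumes m: "0 < m" and P: "P \<in> soc m" and S: "(\<lambda>i. y i + P i) \<in> soc m"
    and orth: "einner m P (\<lambda>i. y i + P i) = 0"
  shows "eproj m (soc m) (\<lambda>i. - y i) = P"
proof -
  let ?S = "\<lambda>i. y i + P i"
  let ?d = "\<lambda>v. enorm m (\<lambda>i. - y i - v i)"
  \<comment> \<open>With \<open>-y = P - S\<close>: \<open>\<parallel>-y - v\<parallel>\<^sup>2 = \<parallel>P - v\<parallel>\<^sup>2 + 2 \<langle>v, S\<rangle> + \<parallel>S\<parallel>\<^sup>2\<close>.\<close>
  have dist: "(?d v)\<^sup>2 \<ge> (enorm m (\<lambda>i. P i - v i))\<^sup>2 + (?d P)\<^sup>2" if "v \<in> soc m" for v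
  proof -
    have "(P i - v i) - ?S i = - y i - v i" for i by simp
    then have "(?d v)\<^sup>2 = (enorm m (\<lambda>i. (P i - v i) - ?S i))\<^sup>2" by (simp only:)
    also have "\<dots> = (enorm m (\<lambda>i. P i - v i))\<^sup>2 - 2 * einner m (\<lambda>i. P i - v i) ?S + (enorm m ?S)\<^sup>2"
      by (rule enorm_diff_power2)
    also have "einner m (\<lambda>i. P i - v i) ?S = einner m P ?S - einner m v ?S"
      by (simp add: einner_def left_diff_distrib sum_subtractf)
    also have "enorm m ?S = ?d P"
      by (simp add: enorm_def L2_set_def) (simp add: power2_eq_square algebra_simps)
    finally show ?thesis using orth einner_soc_nonneg[OF m that S] by simp
  qed
  have P_best: "?d P \<le> ?d v" if "v \<in> soc m" for v
  proof -
    have "(?d P)\<^sup>2 \<le> (?d v)\<^sup>2"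
      using dist[OF that] zero_le_power2[of "enorm m (\<lambda>i. P i - v i)"] by linarith
    then show ?thesis using enorm_nonneg power2_le_imp_le by blast
  qed
  show ?thesis
    unfolding eproj_def
  proof (rule some_equality)
    show "P \<in> soc m \<and> (\<forall>v\<in>soc m. ?d P \<le> ?d v)" using P P_best by blast
    fix z assume z: "z \<in> soc m \<and> (\<forall>v\<in>soc m. ?d z \<le> ?d v)"
    then have "(?d z)\<^sup>2 \<le> (?d P)\<^sup>2" using P enorm_nonneg by (intro power_mono) auto
    with dist[of z] z have "(enorm m (\<lambda>i. P i - z i))\<^sup>2 \<le> 0" by linarith
    then have "enorm m (\<lambda>i. P i - z i) = 0" by simp
    moreover have "(\<lambda>i. P i - z i) \<in> Rn m"
      using P z by (auto simp: soc_def topspace_Euclidean_space)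
    ultimately have "(\<lambda>i. P i - z i) = (\<lambda>_. 0)" using enorm_pos by fastforce
    then show "z = P" by (auto simp: fun_eq_iff)
  qed
qed

text \<open>
  Moreau's criterion holds for the splitting of \<open>- y\<close> into positive and negative parts of the
  eigenvalues.
\<close>

lemma
  assumes m: "0 < m" and y: "y \<in> Rn m" and w: "w \<in> eig_dirs m y"
  shows eproj_neg_spectral: "eproj m (soc m) (\<lambda>i. - y i) = spectral w (neg_eig1 m y) (neg_eig2 m y)"
    and eproj_neg_in_soc: "eproj m (soc m) (\<lambda>i. - y i) \<in> soc m"
    and shift_eproj_neg_in_soc: "(\<lambda>i. y i + eproj m (soc m) (\<lambda>i. - y i) i) \<in> soc m"
    and eproj_neg_orthogonal:
      "einner m (eproj m (soc m) (\<lambda>i. - y i)) (\<lambda>i. y i + eproj m (soc m) (\<lambda>i. - y i) i) = 0"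
    and enorm_eproj_neg:
      "(enorm m (eproj m (soc m) (\<lambda>i. - y i)))\<^sup>2 = ((neg_eig1 m y)\<^sup>2 + (neg_eig2 m y)\<^sup>2) / 2"
proof -
  note unit = m eig_dirs_unit[OF m y w]
  let ?n = "enorm (m - 1) (tail y)"
  let ?P = "spectral w (neg_eig1 m y) (neg_eig2 m y)"
  have shift: "(y 0 - ?n) + neg_eig1 m y = max 0 (y 0 - ?n)"
    "(y 0 + ?n) + neg_eig2 m y = max 0 (y 0 + ?n)"
    by (auto simp: neg_eig1_def neg_eig2_def)
  have "y i + ?P i = spectral w (y 0 - ?n) (y 0 + ?n) i + ?P i" for i
    using spectral_decomposition[OF m y w] by (rule arg_cong[where f = "\<lambda>z. z i + ?P i"])
  also have "\<dots> i = spectral w (y 0 - ?n + neg_eig1 m y) (y 0 + ?n + neg_eig2 m y) i" for i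
    by (simp add: spectral_def algebra_simps)
  finally have S: "(\<lambda>i. y i + ?P i) = spectral w (max 0 (y 0 - ?n)) (max 0 (y 0 + ?n))"
    unfolding shift by (rule ext)
  have S_in: "(\<lambda>i. y i + ?P i) \<in> soc m"
    unfolding S by (rule spectral_in_soc[OF unit]) auto
  have "neg_eig1 m y * max 0 (y 0 - ?n) = 0" "neg_eig2 m y * max 0 (y 0 + ?n) = 0"
    by (auto simp: neg_eig1_def neg_eig2_def max_def)
  then have orth: "einner m ?P (\<lambda>i. y i + ?P i) = 0"
    unfolding S einner_spectral[OF unit] by (simp only:) simp
  have P_in: "?P \<in> soc m"
    by (rule spectral_in_soc[OF unit]) (auto simp: neg_eig1_def neg_eig2_def)
  show *: "eproj m (soc m) (\<lambda>i. - y i) = ?P"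
    by (rule eproj_neg_moreau[OF m P_in S_in orth])
  show "eproj m (soc m) (\<lambda>i. - y i) \<in> soc m"
    unfolding * by (rule P_in)
  show "(\<lambda>i. y i + eproj m (soc m) (\<lambda>i. - y i) i) \<in> soc m"
    unfolding * by (rule S_in)
  show "einner m (eproj m (soc m) (\<lambda>i. - y i)) (\<lambda>i. y i + eproj m (soc m) (\<lambda>i. - y i) i) = 0"
    unfolding * by (rule orth)
  show "(enorm m (eproj m (soc m) (\<lambda>i. - y i)))\<^sup>2 = ((neg_eig1 m y)\<^sup>2 + (neg_eig2 m y)\<^sup>2) / 2"
    unfolding * enorm_power2 einner_spectral[OF unit] by (simp add: power2_eq_square)
qed

text \<open>
  The projection of \<open>- y\<close> has the length of the distance from \<open>y\<close> to the cone. This bound, which is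
  an equality at \<open>s = y + P\<close>, replaces the nonsmooth squared distance by a quadratic majorant that
  touches it, and so avoids differentiating the distance function.
\<close>

lemma enorm_eproj_neg_le:
  assumes m: "2 \<le> m" and y: "y \<in> Rn m" and s: "s \<in> soc m"
  shows "(enorm m (eproj m (soc m) (\<lambda>i. - y i)))\<^sup>2 \<le> (enorm m (\<lambda>i. y i - s i))\<^sup>2"
proof -
  obtain w where w: "w \<in> eig_dirs m y" using eig_dirs_nonempty[OF m] by blast
  have m0: "0 < m" using m by simp
  let ?P = "eproj m (soc m) (\<lambda>i. - y i)"
  let ?S = "\<lambda>i. y i + ?P i"
  note moreau = eproj_neg_in_soc[OF m0 y w] shift_eproj_neg_in_soc[OF m0 y w] eproj_neg_orthogonal[OF m0 y w]
  have "y i - s i = (?S i - s i) - ?P i" for i by simp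
  then have "(enorm m (\<lambda>i. y i - s i))\<^sup>2 = (enorm m (\<lambda>i. (?S i - s i) - ?P i))\<^sup>2" by (simp only:)
  also have "\<dots> = (enorm m (\<lambda>i. ?S i - s i))\<^sup>2 - 2 * einner m (\<lambda>i. ?S i - s i) ?P + (enorm m ?P)\<^sup>2"
    by (rule enorm_diff_power2)
  also have "einner m (\<lambda>i. ?S i - s i) ?P = einner m ?P ?S - einner m s ?P"
    by (simp add: einner_def left_diff_distrib sum_subtractf mult.commute[of "?P _"])
  finally show ?thesis using moreau(3) einner_soc_nonneg[OF m0 s moreau(1)]
      zero_le_power2[of "enorm m (\<lambda>i. ?S i - s i)"] by simp
qed

section \<open>Frontier of the second-order cone\<close>

lemma tendsto_enorm:
  assumes "\<And>i. i < m \<Longrightarrow> ((\<lambda>k. y k i) \<longlongrightarrow> z i) F"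
  shows "((\<lambda>k. enorm m (y k)) \<longlongrightarrow> enorm m z) F"
  unfolding enorm_def L2_set_def by (intro tendsto_intros) (use assms in auto)

lemma openin_Euclidean_space_iff:
  "openin (Euclidean_space m) U \<longleftrightarrow> (\<exists>V. open V \<and> U = Rn m \<inter> V)"
  unfolding topspace_Euclidean_space
  by (auto simp: Euclidean_space_def euclidean_product_topology openin_subtopology Int_commute)

lemma continuous_on_enorm_tail: "continuous_on UNIV (\<lambda>y. enorm m (tail y))"
  unfolding enorm_def L2_set_def tail_def
  by (intro continuous_intros continuous_on_product_coordinates)

lemma frontier_soc:
  assumes "0 < m"
  shows "Euclidean_space m frontier_of soc m = {y \<in> Rn m. enorm (m - 1) (tail y) = y 0}"
proof -
  let ?n = "\<lambda>y. enorm (m - 1) (tail y)"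
  have "closed {y. ?n y \<le> y 0}"
    by (intro closed_Collect_le continuous_on_enorm_tail continuous_on_product_coordinates)
  moreover have "closed (Rn m)" using closedin_Euclidean_space_iff closedin_topspace by blast
  moreover have soc: "soc m = Rn m \<inter> {y. ?n y \<le> y 0}" by (auto simp: soc_def)
  ultimately have "closedin (Euclidean_space m) (soc m)"
    unfolding closedin_Euclidean_space_iff soc by blast
  then have clo: "Euclidean_space m closure_of soc m = soc m" by (simp add: closure_of_closedin)
  have "open {y. ?n y < y 0}"
    by (intro open_Collect_less continuous_on_enorm_tail continuous_on_product_coordinates)
  then have "openin (Euclidean_space m) (Rn m \<inter> {y. ?n y < y 0})"
    unfolding openin_Euclidean_space_iff by blast
  then have int1: "Rn m \<inter> {y. ?n y < y 0} \<subseteq> Euclidean_space m interior_of soc m"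
    by (intro interior_of_maximal) (auto simp: soc_def)
  have int2: "?n y < y 0" if y: "y \<in> Euclidean_space m interior_of soc m" for y
  proof -
    obtain U where U: "openin (Euclidean_space m) U" "y \<in> U" "U \<subseteq> soc m"
      using y by (auto simp: interior_of_def)
    then have yR: "y \<in> Rn m" using openin_subset by blast
    \<comment> \<open>Lowering the leading coordinate of \<open>y\<close> a little must not leave the cone.\<close>
    let ?z = "\<lambda>t::real. \<lambda>i. if i = 0 then y 0 - t else y i"
    obtain V where V: "open V" "U = Rn m \<inter> V"
      using U(1) unfolding openin_Euclidean_space_iff by blast
    have "continuous_on UNIV ?z"
    proof (rule continuous_on_coordinatewise_then_product)
      show "continuous_on UNIV (\<lambda>t. ?z t i)" for i
        by (cases "i = 0") (auto intro!: continuous_intros)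
    qed
    then have "open (?z -` V)" using V(1) by (simp add: open_vimage)
    moreover have "?z 0 = y" by auto
    then have "0 \<in> ?z -` V" using V(2) U(2) by simp
    ultimately obtain e where e: "e > 0" "ball 0 e \<subseteq> ?z -` V"
      by (rule openE)
    have "e/2 \<in> ball 0 e" using e(1) by simp
    then have "?z (e/2) \<in> V" using e(2) by blast
    moreover have "?z (e/2) \<in> Rn m" using yR assms by (auto simp: topspace_Euclidean_space)
    ultimately have "?z (e/2) \<in> soc m" using V U by blast
    moreover have "tail (?z (e/2)) = tail y" by (auto simp: tail_def)
    ultimately have "?n y \<le> y 0 - e/2" by (simp add: soc_def)
    then show ?thesis using e(1) by linarith
  qed
  show ?thesis
    unfolding frontier_of_def clo
  proof (intro subset_antisym subsetI)
    fix y assume "y \<in> soc m - Euclidean_space m interior_of soc m"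
    then have "y \<in> Rn m" "?n y \<le> y 0" "\<not> ?n y < y 0" using int1 by (auto simp only: soc_def)
    then show "y \<in> {y \<in> Rn m. ?n y = y 0}" by simp
  next
    fix y assume "y \<in> {y \<in> Rn m. ?n y = y 0}"
    then have "y \<in> soc m" "?n y = y 0" unfolding soc_def by auto
    then show "y \<in> soc m - Euclidean_space m interior_of soc m" using int2[of y] by auto
  qed
qed

section \<open>Gradients\<close>

lemma grad_eqI:
  assumes "GDERIV h x :> D"
  shows "grad h x = D"
  unfolding grad_def
proof (rule the_equality)
  show "GDERIV h x :> D" by fact
  fix E assume "GDERIV h x :> E"
  then have "(\<lambda>v. inner v E) = (\<lambda>v. inner v D)"
    using assms unfolding gderiv_def by (rule has_derivative_unique)
  then show "E = D" by (metis vector_eq_ldot)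
qed

lemma C1_GDERIV: "C1 h \<Longrightarrow> GDERIV h x :> grad h x"
  unfolding C1_def using grad_eqI by metis

lemma C1_continuous_grad: "C1 h \<Longrightarrow> continuous_on UNIV (grad h)"
  unfolding C1_def using grad_eqI by (metis ext)

lemma C1_continuous: "C1 h \<Longrightarrow> continuous_on UNIV h"
  using C1_GDERIV has_derivative_continuous unfolding gderiv_def
  by (metis continuous_at_imp_continuous_on)

lemma GDERIV_sum:
  "(\<And>i. i \<in> A \<Longrightarrow> GDERIV (h i) x :> D i) \<Longrightarrow> GDERIV (\<lambda>z. \<Sum>i\<in>A. h i z) x :> (\<Sum>i\<in>A. D i)"
  unfolding gderiv_def inner_sum_right by (rule has_derivative_sum)

lemma GDERIV_cmult: "GDERIV h x :> D \<Longrightarrow> GDERIV (\<lambda>z. c * h z) x :> c *\<^sub>R D"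
  unfolding gderiv_def by (auto intro: has_derivative_eq_rhs[OF has_derivative_mult_right])

lemma GDERIV_half_square_dist:
  "GDERIV (\<lambda>z. inner (z - a) (z - a) / 2) x :> x - a"
  unfolding gderiv_def
  by (auto intro!: derivative_eq_intros simp: inner_commute)

lemma C1_map_GDERIV_jac: "C1_map m h \<Longrightarrow> i < m \<Longrightarrow> GDERIV (\<lambda>z. h z i) x :> jac h x i"
  unfolding jac_def C1_map_def by (blast intro: C1_GDERIV)

lemma C1_map_tendsto:
  assumes "C1_map m h" "i < m" "(x \<longlongrightarrow> a) F"
  shows "((\<lambda>k. h (x k) i) \<longlongrightarrow> h a i) F"
proof -
  have "continuous_on UNIV (\<lambda>z. h z i)" using assms C1_continuous by (auto simp: C1_map_def)
  then show ?thesis using assms(3) by (auto intro: continuous_on_tendsto_compose)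
qed

lemma tendsto_jac_transp:
  assumes "C1_map m h" "(x \<longlongrightarrow> a) F" "\<And>i. i < m \<Longrightarrow> ((\<lambda>k. v k i) \<longlongrightarrow> u i) F"
  shows "((\<lambda>k. jac_transp m h (x k) (v k)) \<longlongrightarrow> jac_transp m h a u) F"
proof -
  have "((\<lambda>k. jac h (x k) i) \<longlongrightarrow> jac h a i) F" if "i < m" for i
  proof -
    have "continuous_on UNIV (grad (\<lambda>z. h z i))"
      using assms that C1_continuous_grad by (auto simp: C1_map_def)
    then show ?thesis unfolding jac_def using assms(2) by (auto intro: continuous_on_tendsto_compose)
  qed
  then show ?thesis unfolding jac_transp_def by (intro tendsto_intros) (use assms in auto)
qed

lemma jac_transp_scale: "jac_transp m h x (\<lambda>i. t * v i) = t *\<^sub>R jac_transp m h x v"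
  by (simp add: jac_transp_def scaleR_sum_right)

lemma jac_transp_spectral:
  "jac_transp m h x (spectral w a b) =
     (a / 2) *\<^sub>R jac_transp m h x (case_nat 1 (\<lambda>i. - w i)) + (b / 2) *\<^sub>R jac_transp m h x (case_nat 1 w)"
  by (simp add: jac_transp_def spectral_def u1_def u2_def scaleR_sum_right scaleR_add_left sum.distrib)

section \<open>Limits along an infinite index set\<close>

lemma filterlim_along:
  assumes "strict_mono s" "\<And>k. s k \<in> I"
  shows "filterlim s (along I) sequentially"
  unfolding along_def filterlim_inf filterlim_principal
  using assms by (auto intro: filterlim_subseq)

text \<open>
  Convergence of the eigenvectors is given in the abstract topology; the directions \<open>w\<close> are read off
  from their coordinates.
\<close>

lemma limitin_Euclidean_space_component:
  assumes "limitin (Euclidean_space m) y z F"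
  shows "((\<lambda>k. y k i) \<longlongrightarrow> z i) F"
  using assms unfolding Euclidean_space_def limitin_subtopology limitin_componentwise
  by simp

section \<open>Spectral form of the penalty gradient\<close>

locale nsocp =
  fixes f :: "'a::euclidean_space \<Rightarrow> real"
    and q :: nat and m :: "nat \<Rightarrow> nat"
    and g :: "nat \<Rightarrow> 'a \<Rightarrow> nat \<Rightarrow> real"
  assumes C1_objective: "C1 f"
    and dim: "\<And>j. j \<in> {1..q} \<Longrightarrow> m j \<ge> 2"
    and C1_constraint: "\<And>j. j \<in> {1..q} \<Longrightarrow> C1_map (m j) (g j)"
begin

abbreviation tail_norm :: "nat \<Rightarrow> 'a \<Rightarrow> real" where
  "tail_norm j x \<equiv> enorm (m j - 1) (tail (g j x))"

text \<open>
  For each constraint \<open>j\<close>, by Moreau's decomposition, \<open>g j x + violation j x\<close> lies in the cone and is its point nearest to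
  \<open>g j x\<close>.
\<close>

abbreviation violation :: "nat \<Rightarrow> 'a \<Rightarrow> nat \<Rightarrow> real" where
  "violation j x \<equiv> eproj (m j) (soc (m j)) (\<lambda>l. - g j x l)"

lemma dim_pos: "j \<in> {1..q} \<Longrightarrow> 0 < m j"
  using dim by fastforce

lemma constraint_in_Rn: "j \<in> {1..q} \<Longrightarrow> g j x \<in> Rn (m j)"
  using C1_constraint by (auto simp: C1_map_def)

lemma IB_iff: "j \<in> IB q m g x \<longleftrightarrow> j \<in> {1..q} \<and> g j x \<noteq> (\<lambda>_. 0) \<and> tail_norm j x = g j x 0"
  using dim_pos[of j] constraint_in_Rn[of j x] by (auto simp: IB_def bd_plus_def frontier_soc)

lemma grad_lagrangian:
  "grad (\<lambda>z. lagrangian q m f g z \<mu>) x = grad f x - (\<Sum>j=1..q. jac_transp (m j) (g j) x (\<mu> j))"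
  unfolding lagrangian_def einner_def jac_transp_def
  by (intro grad_eqI GDERIV_diff GDERIV_sum GDERIV_cmult C1_GDERIV C1_objective
      C1_map_GDERIV_jac[OF C1_constraint]) auto

lemma tendsto_tail_norm:
  assumes "j \<in> {1..q}" "(x \<longlongrightarrow> a) F"
  shows "((\<lambda>k. tail_norm j (x k)) \<longlongrightarrow> tail_norm j a) F"
  by (rule tendsto_enorm) (auto simp: tail_def intro!: C1_map_tendsto[OF C1_constraint] assms)

lemma tendsto_leading:
  assumes "j \<in> {1..q}" "(x \<longlongrightarrow> a) F"
  shows "((\<lambda>k. g j (x k) 0) \<longlongrightarrow> g j a 0) F"
  using C1_map_tendsto[OF C1_constraint] dim_pos assms by blast

lemma IB_leading_pos:
  assumes "j \<in> IB q m g x"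
  shows "0 < g j x 0"
proof (rule ccontr)
  assume "\<not> 0 < g j x 0"
  then have z: "g j x 0 = 0" "tail_norm j x = 0"
    using assms enorm_nonneg[of "m j - 1" "tail (g j x)"] by (auto simp: IB_iff)
  have j: "j \<in> {1..q}" using assms by (simp add: IB_iff)
  then have "tail (g j x) \<in> Rn (m j - 1)" using constraint_in_Rn Rn_iff_tail dim_pos by blast
  then have "tail (g j x) = (\<lambda>_. 0)" using z(2) enorm_pos by fastforce
  then have "g j x i = 0" for i using z(1) by (cases i) (auto simp: tail_def fun_eq_iff)
  then show False using assms by (auto simp: IB_iff)
qed

definition index_set :: "'a \<Rightarrow> (nat + nat + nat) set" where
  "index_set x = IB q m g x <+> I0 q g x <+> I0 q g x"

text \<open>
  The coordinates of the gradient of the penalty term in the family \<open>\<D>\<close>. The factor \<open>1/2\<close> at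
  vertices is there because that part of the family uses \<open>(1, \<plusminus>w)\<close>, twice an eigenvector.
\<close>

definition penalty_coeff :: "real \<Rightarrow> 'a \<Rightarrow> nat + nat + nat \<Rightarrow> real" where
  "penalty_coeff \<rho> x = case_sum
     (\<lambda>j. \<rho> * neg_eig1 (m j) (g j x))
     (case_sum (\<lambda>j. \<rho> / 2 * neg_eig1 (m j) (g j x)) (\<lambda>j. \<rho> / 2 * neg_eig2 (m j) (g j x)))"

lemma finite_index_set: "finite (index_set x)"
  by (simp add: index_set_def IB_def I0_def)

lemma penalty_coeff_nonneg: "0 \<le> \<rho> \<Longrightarrow> 0 \<le> penalty_coeff \<rho> x i"
  by (auto simp: penalty_coeff_def neg_eig1_def neg_eig2_def split: sum.splits)

lemma sum_index_set:
  "(\<Sum>i\<in>index_set x. h i) =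
     (\<Sum>j\<in>IB q m g x. h (Inl j)) + (\<Sum>j\<in>I0 q g x. h (Inr (Inl j)) + h (Inr (Inr j)))"
  by (simp add: index_set_def sum.Plus sum.distrib IB_def I0_def)

lemma sum_constraints_split:
  assumes "\<And>j. j \<in> {1..q} - IB q m g x - I0 q g x \<Longrightarrow> h j = 0"
  shows "(\<Sum>j=1..q. h j) = (\<Sum>j\<in>IB q m g x. h j) + (\<Sum>j\<in>I0 q g x. h j)"
proof -
  have "(\<Sum>j=1..q. h j) = (\<Sum>j\<in>IB q m g x \<union> I0 q g x. h j)"
    by (rule sum.mono_neutral_right) (use assms in \<open>auto simp: IB_def I0_def\<close>)
  also have "\<dots> = (\<Sum>j\<in>IB q m g x. h j) + (\<Sum>j\<in>I0 q g x. h j)"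
    by (rule sum.union_disjoint) (auto simp: IB_def I0_def bd_plus_def)
  finally show ?thesis .
qed

lemma normalized_tail_in_eig_dirs:
  "tail_norm j x \<noteq> 0 \<Longrightarrow> (\<lambda>i. tail (g j x) i / tail_norm j x) \<in> eig_dirs (m j) (g j x)"
  by (auto simp: eig_dirs_def enorm_def L2_set_def)

lemma Dfam_boundary_spectral:
  "jac_transp (m j) (g j) x (spectral (\<lambda>i. tail (g j x) i / tail_norm j x) a 0) = a *\<^sub>R Dfam m g x w (Inl j)"
  by (simp add: Dfam_def spectral_def jac_transp_scale)

lemma Dfam_vertex_spectral:
  "jac_transp (m j) (g j) x (spectral (w j) a b) =
     (a / 2) *\<^sub>R Dfam m g x w (Inr (Inl j)) + (b / 2) *\<^sub>R Dfam m g x w (Inr (Inr j))"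
  by (simp add: Dfam_def jac_transp_spectral)

text \<open>
  Near a feasible point \<open>a\<close>, strictly feasible constraints have vanishing projection. A constraint on
  the boundary away from the vertex keeps a positive larger eigenvalue, so its projection is a
  multiple of \<open>u\<^sub>1\<close> alone. At a vertex both eigenvalues can be negative, in any direction \<open>w\<close> that is
  admissible at \<open>x k\<close>. The statement is uniform in \<open>w\<close> because the directions are supplied only along
  an infinite set of indices.
\<close>

lemma eventually_penalty_gradient:
  assumes x: "x \<longlonglongrightarrow> a" and a: "a \<in> feasible q m g"
  shows "\<forall>\<^sub>F k in sequentially. \<forall>\<rho> w. (\<forall>j\<in>I0 q g a. w j \<in> eig_dirs (m j) (g j (x k))) \<longrightarrow>
    (\<Sum>j=1..q. jac_transp (m j) (g j) (x k) (\<lambda>i. \<rho> * violation j (x k) i)) =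
    (\<Sum>i\<in>index_set a. penalty_coeff \<rho> (x k) i *\<^sub>R Dfam m g (x k) w i)"
proof -
  have "\<forall>\<^sub>F k in sequentially. 0 < tail_norm j (x k) \<and> 0 < g j (x k) 0" if "j \<in> IB q m g a" for j
  proof -
    have j: "j \<in> {1..q}" and "0 < tail_norm j a" "0 < g j a 0"
      using that IB_leading_pos[OF that] by (auto simp: IB_iff)
    then show ?thesis
      by (intro eventually_conj order_tendstoD[OF tendsto_tail_norm[OF j x]]
          order_tendstoD[OF tendsto_leading[OF j x]])
  qed
  then have evB: "\<forall>\<^sub>F k in sequentially. \<forall>j\<in>IB q m g a. 0 < tail_norm j (x k) \<and> 0 < g j (x k) 0"
    by (intro eventually_ball_finite) (auto simp: IB_def)
  have "\<forall>\<^sub>F k in sequentially. 0 < g j (x k) 0 - tail_norm j (x k)"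
    if "j \<in> {1..q} - IB q m g a - I0 q g a" for j
  proof -
    have j: "j \<in> {1..q}" "g j a \<in> soc (m j)" using that a by (auto simp: feasible_def)
    then have "tail_norm j a \<le> g j a 0" by (simp add: soc_def)
    moreover have "tail_norm j a \<noteq> g j a 0" using that by (auto simp: IB_iff I0_def)
    ultimately have "0 < g j a 0 - tail_norm j a" by simp
    then show ?thesis
      by (rule order_tendstoD(1)[OF tendsto_diff[OF tendsto_leading[OF j(1) x] tendsto_tail_norm[OF j(1) x]]])
  qed
  then have "\<forall>\<^sub>F k in sequentially. \<forall>j\<in>{1..q} - IB q m g a - I0 q g a. 0 < g j (x k) 0 - tail_norm j (x k)"
    by (intro eventually_ball_finite) auto
  with evB show ?thesis
  proof eventually_elim
    case (elim k)
    show ?case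
    proof (intro allI impI)
      fix \<rho> w assume w: "\<forall>j\<in>I0 q g a. w j \<in> eig_dirs (m j) (g j (x k))"
      let ?T = "\<lambda>j. jac_transp (m j) (g j) (x k) (\<lambda>i. \<rho> * violation j (x k) i)"
      have T: "?T j = \<rho> *\<^sub>R jac_transp (m j) (g j) (x k)
                 (spectral u (neg_eig1 (m j) (g j (x k))) (neg_eig2 (m j) (g j (x k))))"
        if "j \<in> {1..q}" "u \<in> eig_dirs (m j) (g j (x k))" for j u
        using eproj_neg_spectral[OF dim_pos constraint_in_Rn] that by (simp add: jac_transp_scale)
      have B: "?T j = penalty_coeff \<rho> (x k) (Inl j) *\<^sub>R Dfam m g (x k) w (Inl j)"
        if j: "j \<in> IB q m g a" for j
      proof -
        have pos: "0 < tail_norm j (x k)" "0 < g j (x k) 0" using elim j by auto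
        then have "neg_eig2 (m j) (g j (x k)) = 0" by (simp add: neg_eig2_def)
        moreover have "j \<in> {1..q}" using j by (simp add: IB_iff)
        moreover have "tail_norm j (x k) \<noteq> 0" using pos(1) by simp
        ultimately show ?thesis
          unfolding T[OF \<open>j \<in> {1..q}\<close> normalized_tail_in_eig_dirs[OF \<open>tail_norm j (x k) \<noteq> 0\<close>]]
          by (simp only: Dfam_boundary_spectral[where w = w] penalty_coeff_def sum.case scaleR_scaleR)
      qed
      have Z: "?T j = penalty_coeff \<rho> (x k) (Inr (Inl j)) *\<^sub>R Dfam m g (x k) w (Inr (Inl j)) +
                 penalty_coeff \<rho> (x k) (Inr (Inr j)) *\<^sub>R Dfam m g (x k) w (Inr (Inr j))"
        if j: "j \<in> I0 q g a" for j
        using T[of j "w j"] j w by (simp add: I0_def Dfam_vertex_spectral penalty_coeff_def scaleR_add_right)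
      have R: "?T j = 0" if j: "j \<in> {1..q} - IB q m g a - I0 q g a" for j
      proof -
        have jq: "j \<in> {1..q}" using j by simp
        obtain u where u: "u \<in> eig_dirs (m j) (g j (x k))"
          using eig_dirs_nonempty[OF dim[OF jq]] by blast
        have "0 < g j (x k) 0 - tail_norm j (x k)" using elim(2) j by (rule bspec)
        then have "neg_eig1 (m j) (g j (x k)) = 0" "neg_eig2 (m j) (g j (x k)) = 0"
          using enorm_nonneg[of "m j - 1" "tail (g j (x k))"] unfolding neg_eig1_def neg_eig2_def
          by linarith+
        then show ?thesis using T[OF jq u] by (simp add: jac_transp_spectral)
      qed
      show "(\<Sum>j=1..q. ?T j) = (\<Sum>i\<in>index_set a. penalty_coeff \<rho> (x k) i *\<^sub>R Dfam m g (x k) w i)"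
        unfolding sum_index_set using sum_constraints_split[of a ?T] B Z R by simp
    qed
  qed
qed

section \<open>Multipliers in the limit\<close>

text \<open>
  Conversely, nonnegative coordinates of the objective gradient in the family \<open>\<D>\<close> are eigenvalues of
  multipliers. At a boundary point the multiplier lies along \<open>u\<^sub>1\<close> and the constraint value along
  \<open>u\<^sub>2\<close>, so they are orthogonal; at a vertex complementarity is trivial.
\<close>

lemma KKT_from_family:
  assumes a: "a \<in> feasible q m g"
    and wbar: "\<And>j. j \<in> I0 q g a \<Longrightarrow> wbar j \<in> Rn (m j - 1) \<and> enorm (m j - 1) (wbar j) = 1"
    and d: "\<And>i. i \<in> index_set a \<Longrightarrow> 0 \<le> d i"
    and eq: "(\<Sum>i\<in>index_set a. d i *\<^sub>R Dfam m g a wbar i) = grad f a"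
  shows "KKT q m f g a"
proof -
  let ?dir = "\<lambda>j i. tail (g j a) i / tail_norm j a"
  define \<mu> where "\<mu> j =
    (if j \<in> IB q m g a then spectral (?dir j) (d (Inl j)) 0
     else if j \<in> I0 q g a then spectral (wbar j) (2 * d (Inr (Inl j))) (2 * d (Inr (Inr j)))
     else (\<lambda>_. 0))" for j
  have not_IB: "j \<notin> IB q m g a" if "j \<in> I0 q g a" for j
    using that by (auto simp: I0_def IB_iff)
  have dir: "?dir j \<in> eig_dirs (m j) (g j a)" if "j \<in> IB q m g a" for j
    using that IB_leading_pos[OF that] by (intro normalized_tail_in_eig_dirs) (auto simp: IB_iff)
  have dir_unit: "?dir j \<in> Rn (m j - 1)" "enorm (m j - 1) (?dir j) = 1" if "j \<in> IB q m g a" for j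
    using eig_dirs_unit[OF dim_pos constraint_in_Rn dir] that by (auto simp: IB_iff)
  have "\<mu> j \<in> soc (m j) \<and> einner (m j) (\<mu> j) (g j a) = 0" if j: "j \<in> {1..q}" for j
  proof -
    consider "j \<in> IB q m g a" | "j \<in> I0 q g a" | "j \<notin> IB q m g a" "j \<notin> I0 q g a" by blast
    then show ?thesis
    proof cases
      case 1
      then have \<mu>: "\<mu> j = spectral (?dir j) (d (Inl j)) 0" by (simp add: \<mu>_def)
      have "0 \<le> d (Inl j)" using 1 d[of "Inl j"] by (auto simp: index_set_def)
      then have "\<mu> j \<in> soc (m j)"
        unfolding \<mu> by (intro spectral_in_soc dim_pos j dir_unit 1) auto
      moreover have "g j a = spectral (?dir j) 0 (g j a 0 + tail_norm j a)"
        using spectral_decomposition[OF dim_pos[OF j] constraint_in_Rn[OF j] dir[OF 1]] 1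
        by (simp add: IB_iff)
      then have "einner (m j) (\<mu> j) (g j a) =
          einner (m j) (spectral (?dir j) (d (Inl j)) 0) (spectral (?dir j) 0 (g j a 0 + tail_norm j a))"
        unfolding \<mu> by (rule arg_cong)
      then have "einner (m j) (\<mu> j) (g j a) = 0"
        unfolding einner_spectral[OF dim_pos[OF j] dir_unit[OF 1]] by simp
      ultimately show ?thesis by blast
    next
      case 2
      then have \<mu>: "\<mu> j = spectral (wbar j) (2 * d (Inr (Inl j))) (2 * d (Inr (Inr j)))"
        using not_IB by (simp add: \<mu>_def)
      have "0 \<le> d (Inr (Inl j))" "0 \<le> d (Inr (Inr j))" using 2 d[of "Inr _"] by (auto simp: index_set_def)
      then have "\<mu> j \<in> soc (m j)"
        unfolding \<mu> using wbar[OF 2] dim_pos[OF j] by (intro spectral_in_soc) auto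
      moreover have "einner (m j) (\<mu> j) (g j a) = 0" using 2 by (simp add: I0_def einner_def)
      ultimately show ?thesis by blast
    next
      case 3
      then show ?thesis
        by (simp add: \<mu>_def soc_def einner_def enorm_def L2_set_def tail_def topspace_Euclidean_space)
    qed
  qed
  moreover have "(\<Sum>j=1..q. jac_transp (m j) (g j) a (\<mu> j)) = grad f a"
  proof -
    have "jac_transp (m j) (g j) a (\<mu> j) = d (Inl j) *\<^sub>R Dfam m g a wbar (Inl j)"
      if "j \<in> IB q m g a" for j
      using that Dfam_boundary_spectral by (simp add: \<mu>_def)
    moreover have "jac_transp (m j) (g j) a (\<mu> j) =
        d (Inr (Inl j)) *\<^sub>R Dfam m g a wbar (Inr (Inl j)) + d (Inr (Inr j)) *\<^sub>R Dfam m g a wbar (Inr (Inr j))"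
      if "j \<in> I0 q g a" for j
      using that not_IB Dfam_vertex_spectral by (simp add: \<mu>_def)
    moreover have "(\<Sum>j=1..q. jac_transp (m j) (g j) a (\<mu> j)) =
        (\<Sum>j\<in>IB q m g a. jac_transp (m j) (g j) a (\<mu> j)) + (\<Sum>j\<in>I0 q g a. jac_transp (m j) (g j) a (\<mu> j))"
      by (rule sum_constraints_split) (simp add: \<mu>_def jac_transp_def)
    ultimately show ?thesis unfolding eq[symmetric] sum_index_set by simp
  qed
  ultimately show ?thesis
    unfolding KKT_def grad_lagrangian using a by (intro conjI exI[of _ \<mu>]) auto
qed

lemma tendsto_Dfam:
  assumes x: "x \<longlonglongrightarrow> a"
    and w: "\<And>j l. j \<in> I0 q g a \<Longrightarrow> (\<lambda>k. w k j l) \<longlonglongrightarrow> wbar j l"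
    and i: "i \<in> index_set a"
  shows "(\<lambda>k. Dfam m g (x k) (w k) i) \<longlonglongrightarrow> Dfam m g a wbar i"
proof -
  consider j where "i = Inl j" "j \<in> IB q m g a" | j where "i = Inr (Inl j)" "j \<in> I0 q g a"
    | j where "i = Inr (Inr j)" "j \<in> I0 q g a"
    using i by (auto simp: index_set_def)
  then show ?thesis
  proof cases
    case 1
    then have j: "j \<in> {1..q}" and pos: "tail_norm j a \<noteq> 0"
      using IB_leading_pos[of j a] by (auto simp: IB_iff)
    have "(\<lambda>k. tail (g j (x k)) l / tail_norm j (x k)) \<longlonglongrightarrow> tail (g j a) l / tail_norm j a"
      if "Suc l < m j" for l
      using that
      by (intro tendsto_divide tendsto_tail_norm[OF j x] pos) (simp add: tail_nth C1_map_tendsto[OF C1_constraint[OF j] _ x])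
    note normalized_lim = this
    have "(\<lambda>k. u1 (\<lambda>i. tail (g j (x k)) i / tail_norm j (x k)) l) \<longlonglongrightarrow>
        u1 (\<lambda>i. tail (g j a) i / tail_norm j a) l" if "l < m j" for l
    proof (cases l)
      case 0
      then show ?thesis by (simp add: u1_def)
    next
      case (Suc i)
      from tendsto_mult_left[OF normalized_lim[of i], of "- (1 / 2)"] show ?thesis
        using that Suc by (simp add: u1_def mult.commute[of _ 2])
    qed
    then show ?thesis
      unfolding 1 Dfam_def by (auto intro!: tendsto_jac_transp[OF C1_constraint[OF j] x])
  next
    case 2
    have "(\<lambda>k. case_nat 1 (\<lambda>i. - w k j i) l) \<longlonglongrightarrow> case_nat 1 (\<lambda>i. - wbar j i) l" for l
      by (cases l) (auto intro!: tendsto_intros w 2)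
    then show ?thesis
      using 2 unfolding Dfam_def by (auto intro!: tendsto_jac_transp[OF C1_constraint x] simp: I0_def)
  next
    case 3
    have "(\<lambda>k. case_nat 1 (w k j) l) \<longlonglongrightarrow> case_nat 1 (wbar j) l" for l
      by (cases l) (auto intro!: tendsto_intros w 3)
    then show ?thesis
      using 3 unfolding Dfam_def by (auto intro!: tendsto_jac_transp[OF C1_constraint x] simp: I0_def)
  qed
qed

text \<open>
  Each penalty gradient is a conic combination of \<open>\<D>\<close> at \<open>x k\<close>; Caratheodory's theorem makes the
  members in use linearly independent, and the same subfamily is used infinitely often. Weak-CPLD is
  exactly what rules out that this subfamily is positively dependent in the limit, and then the
  limit of the combinations is again a conic combination.
\<close>

proposition KKT_of_penalty_sequence:
  assumes \<rho>: "filterlim \<rho> at_top sequentially"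
    and x: "x \<longlonglongrightarrow> a" and a: "a \<in> feasible q m g"
    and stat: "(\<lambda>k. grad (\<lambda>z. lagrangian q m f g z (\<lambda>j i. \<rho> k * violation j (x k) i)) (x k)) \<longlonglongrightarrow> 0"
    and cpld: "weak_CPLD q m g a"
  shows "KKT q m f g a"
proof -
  from cpld[unfolded weak_CPLD_def, THEN spec, THEN mp, OF x] obtain I w wbar where I: "infinite I"
    and w: "\<forall>k\<in>I. \<forall>j\<in>I0 q g a. w k j \<in> eig_dirs (m j) (g j (x k))"
    and wbar: "\<forall>j\<in>I0 q g a. wbar j \<in> Rn (m j - 1) \<and> enorm (m j - 1) (wbar j) = 1 \<and>
           limitin (Euclidean_space (m j)) (\<lambda>k. u1 (w k j)) (u1 (wbar j)) (along I) \<and>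
           limitin (Euclidean_space (m j)) (\<lambda>k. u2 (w k j)) (u2 (wbar j)) (along I)"
    and dep: "\<forall>JB Jm Jp. JB \<subseteq> IB q m g a \<longrightarrow> Jm \<subseteq> I0 q g a \<longrightarrow> Jp \<subseteq> I0 q g a \<longrightarrow>
           fam_pos_lin_dep (JB <+> Jm <+> Jp) (Dfam m g a wbar) \<longrightarrow>
           (\<forall>\<^sub>F k in along I. fam_lin_dep (JB <+> Jm <+> Jp) (Dfam m g (x k) (w k)))"
    by (elim exE conjE) (rule that; assumption)
  let ?v = "\<lambda>k. Dfam m g (x k) (w k)"
  define T where "T k = (\<Sum>j=1..q. jac_transp (m j) (g j) (x k) (\<lambda>i. \<rho> k * violation j (x k) i))" for k
  have ev: "\<forall>\<^sub>F k in sequentially. 0 \<le> \<rho> k \<and>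
      (k \<in> I \<longrightarrow> T k = (\<Sum>i\<in>index_set a. penalty_coeff (\<rho> k) (x k) i *\<^sub>R ?v k i))"
    using eventually_penalty_gradient[OF x a] \<rho>[unfolded filterlim_at_top, rule_format, of 0]
  proof eventually_elim
    case (elim k)
    show ?case
      unfolding T_def using elim(2) elim(1)[rule_format, of "w k" "\<rho> k"] w by blast
  qed
  \<comment> \<open>The indices at which the expansion of the penalty gradient is available.\<close>
  define K where "K = {k \<in> I. 0 \<le> \<rho> k \<and> T k = (\<Sum>i\<in>index_set a. penalty_coeff (\<rho> k) (x k) i *\<^sub>R ?v k i)}"
  obtain k0 where "\<forall>k\<ge>k0. k \<in> I \<longrightarrow> k \<in> K"
    using ev unfolding eventually_sequentially K_def by auto
  then have "I - {..<k0} \<subseteq> K" by (meson DiffE lessThan_iff not_less subsetI)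
  then have K_inf: "infinite K" using I by (meson Diff_infinite_finite finite_lessThan finite_subset)
  define reduced where "reduced k B d \<longleftrightarrow> B \<subseteq> index_set a \<and> (\<forall>i\<in>B. 0 \<le> d i) \<and> \<not> fam_lin_dep B (?v k) \<and>
      (\<Sum>i\<in>B. d i *\<^sub>R ?v k i) = T k" for k B d
  have "\<forall>k\<in>K. \<exists>B d. reduced k B d"
  proof
    fix k assume k: "k \<in> K"
    then have coeff: "0 \<le> penalty_coeff (\<rho> k) (x k) i" for i
      using penalty_coeff_nonneg by (simp add: K_def)
    obtain B d where "B \<subseteq> index_set a" "\<And>i. i \<in> B \<Longrightarrow> 0 \<le> d i" "\<not> fam_lin_dep B (?v k)"
      "(\<Sum>i\<in>B. d i *\<^sub>R ?v k i) = (\<Sum>i\<in>index_set a. penalty_coeff (\<rho> k) (x k) i *\<^sub>R ?v k i)"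
      by (rule conic_caratheodory_family[OF finite_index_set[of a],
            of "penalty_coeff (\<rho> k) (x k)" "?v k", OF coeff]) (rule that)
    with k show "\<exists>B d. reduced k B d" by (auto simp: K_def reduced_def)
  qed
  then obtain B d where "\<And>k. k \<in> K \<Longrightarrow> reduced k (B k) (d k)" by metis
  then have Bd: "\<And>k. k \<in> K \<Longrightarrow> B k \<subseteq> index_set a \<and> (\<forall>i\<in>B k. 0 \<le> d k i) \<and>
      \<not> fam_lin_dep (B k) (?v k) \<and> (\<Sum>i\<in>B k. d k i *\<^sub>R ?v k i) = T k"
    unfolding reduced_def .
  have "B ` K \<subseteq> Pow (index_set a)" using Bd by blast
  then have "finite (B ` K)" using finite_index_set by (meson finite_Pow_iff finite_subset)
  then obtain k1 where k1: "k1 \<in> K" "infinite {k \<in> K. B k = B k1}"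
    by (elim pigeonhole_infinite[OF K_inf, THEN bexE]) (rule that)
  obtain s where s: "strict_mono (s :: nat \<Rightarrow> nat)" "\<And>n. s n \<in> K" "\<And>n. B (s n) = B k1"
    using infinite_enumerate[OF k1(2)] by auto
  have sI: "filterlim s (along I) sequentially"
    using s by (intro filterlim_along) (auto simp: K_def)
  have xs: "(\<lambda>n. x (s n)) \<longlonglongrightarrow> a" using LIMSEQ_subseq_LIMSEQ[OF x s(1)] by (simp add: o_def)
  have ws: "(\<lambda>n. w (s n) j l) \<longlonglongrightarrow> wbar j l" if "j \<in> I0 q g a" for j l
  proof -
    have "((\<lambda>k. u1 (w k j) (Suc l)) \<longlongrightarrow> u1 (wbar j) (Suc l)) (along I)"
      using wbar that by (intro limitin_Euclidean_space_component) auto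
    from tendsto_mult_left[OF filterlim_compose[OF this sI], of "- 2"] show ?thesis
      by (simp add: u1_def)
  qed
  have B_sub: "B k1 \<subseteq> index_set a" using Bd k1 by blast
  have indep: "\<not> fam_pos_lin_dep (B k1) (Dfam m g a wbar)"
  proof
    assume pos: "fam_pos_lin_dep (B k1) (Dfam m g a wbar)"
    define JB where "JB = {j. Inl j \<in> B k1}"
    define Jm where "Jm = {j. Inr (Inl j) \<in> B k1}"
    define Jp where "Jp = {j. Inr (Inr j) \<in> B k1}"
    have B_eq: "B k1 = JB <+> Jm <+> Jp"
    proof (rule set_eqI)
      show "i \<in> B k1 \<longleftrightarrow> i \<in> JB <+> Jm <+> Jp" for i
        by (cases i; cases "projr i") (auto simp: JB_def Jm_def Jp_def)
    qed
    have "JB \<subseteq> IB q m g a" "Jm \<subseteq> I0 q g a" "Jp \<subseteq> I0 q g a"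
      using B_sub by (auto simp: JB_def Jm_def Jp_def index_set_def)
    then have "\<forall>\<^sub>F k in along I. fam_lin_dep (B k1) (?v k)" using dep pos unfolding B_eq by blast
    then have "\<forall>\<^sub>F n in sequentially. fam_lin_dep (B k1) (?v (s n))"
      by (rule eventually_compose_filterlim[OF _ sI])
    then obtain n where "fam_lin_dep (B k1) (?v (s n))" by (auto simp: eventually_sequentially)
    then show False using Bd[OF s(2)[of n]] s(3)[of n] by simp
  qed
  have T_lim: "(\<lambda>n. T (s n)) \<longlonglongrightarrow> grad f a"
  proof -
    have "(\<lambda>k. grad f (x k)) \<longlonglongrightarrow> grad f a"
      by (rule continuous_on_tendsto_compose[OF C1_continuous_grad[OF C1_objective] x]) auto
    from tendsto_diff[OF this stat] have "T \<longlonglongrightarrow> grad f a"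
      unfolding grad_lagrangian T_def by simp
    then show ?thesis using LIMSEQ_subseq_LIMSEQ[OF _ s(1)] by (auto simp: o_def)
  qed
  obtain e where e: "\<And>i. i \<in> B k1 \<Longrightarrow> 0 \<le> e i" "(\<Sum>i\<in>B k1. e i *\<^sub>R Dfam m g a wbar i) = grad f a"
  proof (rule limit_in_cone[where A = "B k1" and v = "\<lambda>n. ?v (s n)" and c = "\<lambda>n. d (s n)"])
    show "finite (B k1)" using B_sub finite_index_set finite_subset by blast
    show "(\<lambda>n. ?v (s n) i) \<longlonglongrightarrow> Dfam m g a wbar i" if "i \<in> B k1" for i
      using that B_sub by (intro tendsto_Dfam xs ws) auto
    show "0 \<le> d (s n) i" if "i \<in> B k1" for n i using Bd[OF s(2)[of n]] s(3)[of n] that by simp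
    show "(\<lambda>n. \<Sum>i\<in>B k1. d (s n) i *\<^sub>R ?v (s n) i) \<longlonglongrightarrow> grad f a"
      using T_lim Bd[OF s(2)] s(3) by simp
  qed (use indep in auto)
  define e' where "e' i = (if i \<in> B k1 then e i else 0)" for i
  have "(\<Sum>i\<in>index_set a. e' i *\<^sub>R Dfam m g a wbar i) = (\<Sum>i\<in>B k1. e i *\<^sub>R Dfam m g a wbar i)"
    by (rule sum.mono_neutral_cong_right) (use B_sub finite_index_set in \<open>auto simp: e'_def\<close>)
  with e have "(\<Sum>i\<in>index_set a. e' i *\<^sub>R Dfam m g a wbar i) = grad f a" by simp
  then show ?thesis using e(1) wbar by (intro KKT_from_family[OF a]) (auto simp: e'_def)
qed


section \<open>Penalty sequences at a local minimizer\<close>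

definition penalty :: "'a \<Rightarrow> real" where
  "penalty x = (\<Sum>j=1..q. (enorm (m j) (violation j x))\<^sup>2)"

text \<open>
  The proximal term \<open>\<parallel>x - a\<parallel>\<^sup>2 / 2\<close> turns the local minimizer \<open>a\<close> into a strict one, which forces the
  minimizers of the penalized problems to converge to \<open>a\<close>; its gradient vanishes in the limit.
\<close>

definition merit :: "'a \<Rightarrow> real \<Rightarrow> 'a \<Rightarrow> real" where
  "merit a \<rho> x = f x + inner (x - a) (x - a) / 2 + \<rho> / 2 * penalty x"

lemma penalty_nonneg: "0 \<le> penalty x"
  by (simp add: penalty_def sum_nonneg)

lemma continuous_penalty: "continuous_on UNIV penalty"
proof -
  have "penalty x = (\<Sum>j=1..q. ((neg_eig1 (m j) (g j x))\<^sup>2 + (neg_eig2 (m j) (g j x))\<^sup>2) / 2)" for x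
    unfolding penalty_def
  proof (rule sum.cong[OF refl])
    fix j assume j: "j \<in> {1..q}"
    obtain w where "w \<in> eig_dirs (m j) (g j x)" using eig_dirs_nonempty[OF dim[OF j]] by blast
    then show "(enorm (m j) (violation j x))\<^sup>2 = ((neg_eig1 (m j) (g j x))\<^sup>2 + (neg_eig2 (m j) (g j x))\<^sup>2) / 2"
      by (rule enorm_eproj_neg[OF dim_pos[OF j] constraint_in_Rn[OF j]])
  qed
  then have eq: "penalty = (\<lambda>x. \<Sum>j=1..q. ((neg_eig1 (m j) (g j x))\<^sup>2 + (neg_eig2 (m j) (g j x))\<^sup>2) / 2)"
    by (rule ext)
  have "continuous_on UNIV (tail_norm j)" "continuous_on UNIV (\<lambda>x. g j x 0)" if "j \<in> {1..q}" for j
    using tendsto_tail_norm[OF that tendsto_ident_at] tendsto_leading[OF that tendsto_ident_at]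
    unfolding continuous_on_def by auto
  then show ?thesis
    unfolding eq neg_eig1_def neg_eig2_def by (intro continuous_intros) auto
qed

lemma feasible_if_penalty_zero:
  assumes "penalty x = 0"
  shows "x \<in> feasible q m g"
proof -
  have "g j x \<in> soc (m j)" if j: "j \<in> {1..q}" for j
  proof -
    obtain w where w: "w \<in> eig_dirs (m j) (g j x)" using eig_dirs_nonempty[OF dim[OF j]] by blast
    note y = dim_pos[OF j] constraint_in_Rn[OF j] w
    have "enorm (m j) (violation j x) = 0"
      using assms j by (auto simp: penalty_def sum_nonneg_eq_0_iff)
    moreover have "violation j x \<in> Rn (m j)" using eproj_neg_in_soc[OF y] by (simp add: soc_def)
    ultimately have "violation j x = (\<lambda>_. 0)" using enorm_pos by fastforce
    then show ?thesis using shift_eproj_neg_in_soc[OF y] by simp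
  qed
  then show ?thesis by (simp add: feasible_def)
qed

lemma penalty_feasible:
  assumes "x \<in> feasible q m g"
  shows "penalty x = 0"
proof -
  have "(enorm (m j) (violation j x))\<^sup>2 = 0" if j: "j \<in> {1..q}" for j
  proof -
    have "(enorm (m j) (violation j x))\<^sup>2 \<le> (enorm (m j) (\<lambda>i. g j x i - g j x i))\<^sup>2"
      using assms j by (intro enorm_eproj_neg_le dim constraint_in_Rn) (auto simp: feasible_def)
    then show ?thesis by (simp add: enorm_def L2_set_def)
  qed
  then show ?thesis by (simp add: penalty_def)
qed

lemma continuous_merit: "continuous_on UNIV (merit a \<rho>)"
  unfolding merit_def
  by (intro continuous_intros continuous_penalty C1_continuous[OF C1_objective]) auto

text \<open>
  A minimizer of the merit function also minimizes the smooth function \<open>G\<close> that measures the distance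
  from \<open>g j z\<close> to the fixed cone point nearest to \<open>g j x\<close>, since \<open>G\<close> lies above the merit function and
  agrees with it at \<open>x\<close>. Fermat's rule is applied to \<open>G\<close>.
\<close>

lemma merit_minimizer_stationary:
  assumes S: "open S" "x \<in> S" and min: "\<And>z. z \<in> S \<Longrightarrow> merit a \<rho> x \<le> merit a \<rho> z"
    and \<rho>: "0 \<le> \<rho>"
  shows "grad (\<lambda>z. lagrangian q m f g z (\<lambda>j i. \<rho> * violation j x i)) x = - (x - a)"
proof -
  let ?s = "\<lambda>j i. g j x i + violation j x i"
  define G where "G z = f z + inner (z - a) (z - a) / 2 +
    \<rho> / 2 * (\<Sum>j=1..q. \<Sum>i<m j. (g j z i - ?s j i) * (g j z i - ?s j i))" for z
  have sq: "(enorm n (\<lambda>i. y i - s i))\<^sup>2 = (\<Sum>i<n. (y i - s i) * (y i - s i))" for n y s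
    by (simp add: enorm_power2 einner_def)
  have s_soc: "?s j \<in> soc (m j)" if j: "j \<in> {1..q}" for j
    using eig_dirs_nonempty[OF dim[OF j]] shift_eproj_neg_in_soc[OF dim_pos[OF j] constraint_in_Rn[OF j]]
    by blast
  have "merit a \<rho> z \<le> G z" for z
  proof -
    have "penalty z \<le> (\<Sum>j=1..q. \<Sum>i<m j. (g j z i - ?s j i) * (g j z i - ?s j i))"
      unfolding penalty_def sq[symmetric]
      by (intro sum_mono enorm_eproj_neg_le dim constraint_in_Rn s_soc)
    then show ?thesis unfolding merit_def G_def using \<rho> by (simp add: mult_left_mono)
  qed
  moreover have "G x = merit a \<rho> x"
    unfolding merit_def G_def penalty_def by (simp add: enorm_power2 einner_def)
  ultimately have G_min: "\<forall>z\<in>S. G x \<le> G z" using min order_trans by metis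
  let ?D = "grad f x + (x - a) + (\<rho> / 2) *\<^sub>R (\<Sum>j=1..q. \<Sum>i<m j.
      (g j x i - ?s j i) *\<^sub>R (jac (g j) x i - 0) + (g j x i - ?s j i) *\<^sub>R (jac (g j) x i - 0))"
  have "GDERIV G x :> ?D"
    unfolding G_def
    by (intro GDERIV_add GDERIV_cmult GDERIV_sum GDERIV_mult GDERIV_diff GDERIV_const
        GDERIV_half_square_dist C1_GDERIV C1_objective C1_map_GDERIV_jac[OF C1_constraint]) auto
  then have "(G has_derivative (\<lambda>h. inner h ?D)) (at x)" by (simp only: gderiv_def)
  then have "(\<lambda>h. inner h ?D) = (\<lambda>h. 0)"
    by (rule differential_zero_maxmin[OF S(2,1)]) (use G_min in blast)
  from fun_cong[OF this, of ?D] have "inner ?D ?D = 0" .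
  then have "?D = 0" by (simp only: inner_eq_zero_iff)
  moreover have "(\<Sum>j=1..q. jac_transp (m j) (g j) x (\<lambda>i. \<rho> * violation j x i)) =
     - ((\<rho> / 2) *\<^sub>R (\<Sum>j=1..q. \<Sum>i<m j.
      (g j x i - ?s j i) *\<^sub>R (jac (g j) x i - 0) + (g j x i - ?s j i) *\<^sub>R (jac (g j) x i - 0)))"
  proof -
    have "(\<rho> / 2) *\<^sub>R ((g j x i - ?s j i) *\<^sub>R (jac (g j) x i - 0) + (g j x i - ?s j i) *\<^sub>R (jac (g j) x i - 0))
        = - ((\<rho> * violation j x i) *\<^sub>R jac (g j) x i)" for j i
      unfolding scaleR_left_distrib[symmetric] by simp
    then show ?thesis unfolding jac_transp_def scaleR_sum_right by (simp only: sum_negf minus_minus)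
  qed
  ultimately show ?thesis unfolding grad_lagrangian by (simp add: algebra_simps)
qed

text \<open>
  The classical external penalty argument. A subsequence of the minimizers over a small ball
  converges to some \<open>z\<close>; boundedness of the merit values by \<open>f a\<close> forces \<open>z\<close> to be feasible, and
  local minimality of \<open>a\<close> then forces the proximal term to vanish at \<open>z\<close>.
\<close>

proposition penalty_sequence_at_local_minimizer:
  assumes "local_minimizer q m f g a"
  obtains \<rho> x where "filterlim \<rho> at_top sequentially" "x \<longlonglongrightarrow> a"
    "(\<lambda>k. grad (\<lambda>z. lagrangian q m f g z (\<lambda>j i. \<rho> k * violation j (x k) i)) (x k)) \<longlonglongrightarrow> 0"
proof -
  from assms obtain e where a: "a \<in> feasible q m g" and e: "e > 0"
    and loc: "\<And>y. y \<in> feasible q m g \<Longrightarrow> y \<in> ball a e \<Longrightarrow> f a \<le> f y"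
    unfolding local_minimizer_def by blast
  \<comment> \<open>Half the radius, so that limits of minimizers stay in the open ball of local minimality.\<close>
  define C where "C = cball a (e / 2)"
  have C: "compact C" "C \<noteq> {}" "a \<in> C" using e by (auto simp: C_def)
  have cont_f: "continuous_on UNIV f" by (rule C1_continuous[OF C1_objective])
  have "\<exists>x\<in>C. \<forall>z\<in>C. merit a (real (Suc k)) x \<le> merit a (real (Suc k)) z" for k
    by (intro continuous_attains_inf C continuous_on_subset[OF continuous_merit]) auto
  then obtain y where yC: "\<And>k. y k \<in> C"
    and y_min: "\<And>k z. z \<in> C \<Longrightarrow> merit a (real (Suc k)) (y k) \<le> merit a (real (Suc k)) z"
    by metis
  obtain z r where z: "z \<in> C" and r: "strict_mono (r :: nat \<Rightarrow> nat)" and yz: "(y \<circ> r) \<longlonglongrightarrow> z"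
    using C(1) yC unfolding compact_def by metis
  obtain x0 where x0: "\<forall>x\<in>C. f x0 \<le> f x"
    using continuous_attains_inf[OF C(1,2) continuous_on_subset[OF cont_f]] by auto
  \<comment> \<open>Comparing with the feasible competitor \<open>a\<close>, whose penalty is zero.\<close>
  have merit_a: "merit a \<rho> a = f a" for \<rho> by (simp add: merit_def penalty_feasible[OF a])
  have le: "f (y k) + inner (y k - a) (y k - a) / 2 + real (Suc k) / 2 * penalty (y k) \<le> f a" for k
    using y_min[OF C(3), of k] unfolding merit_a by (simp add: merit_def)
  have pen_le: "penalty (y k) \<le> 2 * (f a - f x0) * inverse (real (Suc k))" for k
  proof -
    have "f x0 + real (Suc k) / 2 * penalty (y k) \<le> f a"
      using le[of k] bspec[OF x0 yC[of k]] inner_ge_zero[of "y k - a"] by linarith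
    then show ?thesis by (simp add: field_simps)
  qed
  have bound_lim: "(\<lambda>k. 2 * (f a - f x0) * inverse (real (Suc (r k)))) \<longlonglongrightarrow> 2 * (f a - f x0) * 0"
    by (intro tendsto_intros LIMSEQ_subseq_LIMSEQ[OF LIMSEQ_inverse_real_of_nat r, unfolded o_def])
  have "(\<lambda>k. penalty (y (r k))) \<longlonglongrightarrow> penalty z"
    using continuous_on_tendsto_compose[OF continuous_penalty yz] by (simp add: o_def)
  then have "penalty z \<le> 2 * (f a - f x0) * 0"
    by (rule LIMSEQ_le[OF _ bound_lim]) (use pen_le in blast)
  then have "z \<in> feasible q m g"
    using penalty_nonneg[of z] by (intro feasible_if_penalty_zero) simp
  then have fz: "f a \<le> f z" using z e by (intro loc) (auto simp: C_def)
  have "(\<lambda>k. f (y (r k)) + inner (y (r k) - a) (y (r k) - a) / 2) \<longlonglongrightarrow> f z + inner (z - a) (z - a) / 2"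
    using yz continuous_on_tendsto_compose[OF cont_f yz]
    by (intro tendsto_intros) (auto simp: o_def)
  moreover have "f (y k) + inner (y k - a) (y k - a) / 2 \<le> f a" for k
    using le[of k] penalty_nonneg[of "y k"] by (smt (verit) mult_nonneg_nonneg divide_nonneg_nonneg of_nat_0_le_iff)
  ultimately have "f z + inner (z - a) (z - a) / 2 \<le> f a"
    by (intro LIMSEQ_le_const2) auto
  then have "inner (z - a) (z - a) \<le> 0" using fz by simp
  then have "z = a"
    using inner_ge_zero[of "z - a"] by (metis antisym eq_iff_diff_eq_0 inner_eq_zero_iff)
  with yz have x_lim: "(\<lambda>k. y (r k)) \<longlonglongrightarrow> a" by (simp add: o_def)
  define x where "x k = y (r k)" for k
  define \<rho> where "\<rho> k = real (Suc (r k))" for k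
  have "\<forall>\<^sub>F k in sequentially. x k \<in> ball a (e / 2)"
    using topological_tendstoD[OF x_lim, of "ball a (e / 2)"] e by (simp add: x_def)
  then have "\<forall>\<^sub>F k in sequentially. - (x k - a) =
      grad (\<lambda>z. lagrangian q m f g z (\<lambda>j i. \<rho> k * violation j (x k) i)) (x k)"
  proof eventually_elim
    case (elim k)
    have "grad (\<lambda>z. lagrangian q m f g z (\<lambda>j i. \<rho> k * violation j (x k) i)) (x k) = - (x k - a)"
    proof (rule merit_minimizer_stationary[OF open_ball elim])
      show "merit a (\<rho> k) (x k) \<le> merit a (\<rho> k) z" if "z \<in> ball a (e / 2)" for z
        unfolding x_def \<rho>_def using that by (intro y_min) (auto simp: C_def)
    qed (simp add: \<rho>_def)
    then show ?case by (rule sym)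
  qed
  moreover have "(\<lambda>k. - (x k - a)) \<longlonglongrightarrow> - (a - a)"
    unfolding x_def by (intro tendsto_intros x_lim)
  ultimately have stat:
    "(\<lambda>k. grad (\<lambda>z. lagrangian q m f g z (\<lambda>j i. \<rho> k * violation j (x k) i)) (x k)) \<longlonglongrightarrow> 0"
    using Lim_transform_eventually by fastforce
  have "filterlim (\<lambda>k. real (Suc k)) at_top sequentially"
    using filterlim_compose[OF filterlim_real_sequentially filterlim_Suc] .
  then have "filterlim \<rho> at_top sequentially"
    unfolding \<rho>_def using filterlim_compose[OF _ filterlim_subseq[OF r]] by blast
  then show thesis using that x_lim stat unfolding x_def by blast
qed

end

theorem theorem4p2:
  fixes f :: "real ^ 'n \<Rightarrow> real"
    and q :: nat and m :: "nat \<Rightarrow> nat"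
    and g :: "nat \<Rightarrow> real ^ 'n \<Rightarrow> nat \<Rightarrow> real"
  assumes "C1 f"
    and "\<And>j. j \<in> {1..q} \<Longrightarrow> m j \<ge> 2"
    and "\<And>j. j \<in> {1..q} \<Longrightarrow> C1_map (m j) (g j)"
  shows "(\<forall>(\<rho> :: nat \<Rightarrow> real) (x :: nat \<Rightarrow> real ^ 'n) xbar.
            filterlim \<rho> at_top sequentially \<longrightarrow>
            x \<longlonglongrightarrow> xbar \<longrightarrow>
            xbar \<in> feasible q m g \<longrightarrow>
            (\<lambda>k. grad (\<lambda>z. lagrangian q m f g z
                   (\<lambda>j i. \<rho> k * eproj (m j) (soc (m j)) (\<lambda>l. - g j (x k) l) i)) (x k)) \<longlonglongrightarrow> 0 \<longrightarrow>
            weak_CPLD q m g xbar \<longrightarrow>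
            KKT q m f g xbar) \<and>
         (\<forall>xbar. local_minimizer q m f g xbar \<longrightarrow> weak_CPLD q m g xbar \<longrightarrow> KKT q m f g xbar)"
proof -
  interpret nsocp f q m g
    using assms by unfold_locales
  show ?thesis
  proof (intro conjI allI impI)
    fix xbar assume loc: "local_minimizer q m f g xbar" and cpld: "weak_CPLD q m g xbar"
    then have feas: "xbar \<in> feasible q m g" by (simp add: local_minimizer_def)
    obtain \<rho> x where "filterlim \<rho> at_top sequentially" "x \<longlonglongrightarrow> xbar"
      "(\<lambda>k. grad (\<lambda>z. lagrangian q m f g z (\<lambda>j i. \<rho> k * violation j (x k) i)) (x k)) \<longlonglongrightarrow> 0"
      using penalty_sequence_at_local_minimizer[OF loc] .
    then show "KKT q m f g xbar" using KKT_of_penalty_sequence feas cpld by blast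
  qed (rule KKT_of_penalty_sequence)
qed

end
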